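(* Let $\alpha\in\mathbb R$, let $\kappa\in\mathbb N_0\cup\{+\infty\}$, let $(s_j)_{j=0}^\kappa\in\mathcal K^{\ge,e}_{q,\kappa,\alpha}$, and let $k$ be an integer with $0\le k\le\kappa$. Let $(t_j)_{j=0}^{\kappa-k}$ be the $k$-th $\alpha$-Schur transform of $(s_j)_{j=0}^\kappa$ and let $(Q_j)_{j=0}^\kappa$ be the right $\alpha$-Stieltjes parametrization of $(s_j)_{j=0}^\kappa$. Then $(Q_{k+j})_{j=0}^{\kappa-k}$ is exactly the right $\alpha$-Stieltjes parametrization of $(t_j)_{j=0}^{\kappa-k}$.
   Context: Let $q\in\mathbb N=\{1,2,\dots\}$; $\mathbb N_0=\{0,1,2,\dots\}$. All sequences consist of complex $q\times q$ matrices; $(s_j)_{j=0}^{\infty}$ is indexed by $\mathbb N_0$, and $\infty-k=\infty$. $A\ge0$ means that $A$ is nonnegative Hermitian (Hermitian positive semidefinite), and $A^\dagger$ is the Moore–Penrose inverse of $A$. Block Hankel matrices. For a sequence $(s_j)$ put $H_n=[s_{j+k}]_{j,k=0}^n$, $s_{\alpha,j}=-\alpha s_j+s_{j+1}$, and $H_{\alpha,n}=[s_{\alpha,j+k}]_{j,k=0}^n$ (whenever the entries are available). Classes. $\mathcal K^{\ge}_{q,0,\alpha}$ is the set of all $(s_j)_{j=0}^0$ with $s_0\ge0$. For $n\ge1$, $\mathcal K^{\ge}_{q,2n,\alpha}$ is the set of all $(s_j)_{j=0}^{2n}$ with $H_n\ge0$ and $H_{\alpha,n-1}\ge0$. For $n\ge0$,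 $\mathcal K^{\ge}_{q,2n+1,\alpha}$ is the set of all $(s_j)_{j=0}^{2n+1}$ with $H_n\ge0$ and $H_{\alpha,n}\ge0$. $\mathcal K^{\ge}_{q,\infty,\alpha}$ is the set of all $(s_j)_{j=0}^\infty$ with $(s_j)_{j=0}^m\in\mathcal K^{\ge}_{q,m,\alpha}$ for all $m\in\mathbb N_0$. For $m\in\mathbb N_0$, $\mathcal K^{\ge,e}_{q,m,\alpha}$ is the set of all $(s_j)_{j=0}^m$ for which there is a complex $q\times q$ matrix $s_{m+1}$ with $(s_j)_{j=0}^{m+1}\in\mathcal K^{\ge}_{q,m+1,\alpha}$; $\mathcal K^{\ge,e}_{q,\infty,\alpha}=\mathcal K^{\ge}_{q,\infty,\alpha}$. Right $\alpha$-Stieltjes parametrization. Put $L_0=s_0$ and, for $n\ge1$, $L_n=s_{2n}-[s_n,\dots,s_{2n-1}]\,H_{n-1}^\dagger\,\begin{bmatrix}s_n\\ \vdots\\ s_{2n-1}\end{bmatrix}$; let $L_{\alpha,n}$ be the matrix built in the same way from the sequence $(s_{\alpha,j})$ in place of $(s_j)$ (so $L_{\alpha,0}=s_{\alpha,0}$). The right $\alpha$-Stieltjes parametrization $(Q_j)_{j=0}^\kappa$ of $(s_j)_{j=0}^\kappa$ is given by $Q_{2k}=L_k$ and $Q_{2k+1}=L_{\alpha,k}$ for all indices not exceeding $\kappa$. $\alpha$-Schur transforms. The $[+,\alpha]$-transform of $(s_j)$ is $(u_j)$ with $u_j=-\alpha s_{j-1}+s_j$, where $s_{-1}=0$. The reciprocal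 sequence of a sequence $(u_j)$ is given by $u_0^\sharp=u_0^\dagger$ and $u_j^\sharp=-u_0^\dagger\sum_{l=0}^{j-1}u_{j-l}u_l^\sharp$ for $j\ge1$. Put $s_j^{\sharp,\alpha}=u_j^\sharp$ where $(u_j)$ is the $[+,\alpha]$-transform of $(s_j)$. The first $\alpha$-Schur transform of a sequence $(s_j)_{j=0}^{\kappa}$ with $\kappa\ge1$ is $(s_j^{[1,\alpha]})_{j=0}^{\kappa-1}$ with $s_j^{[1,\alpha]}=-s_0\,s_{j+1}^{\sharp,\alpha}\,s_0$. The $0$-th $\alpha$-Schur transform of $(s_j)$ is $(s_j)$ itself, and for integers $1\le k\le\kappa$ the $k$-th $\alpha$-Schur transform $(s_j^{[k,\alpha]})_{j=0}^{\kappa-k}$ is the first $\alpha$-Schur transform of the $(k-1)$-th one. *)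

theory Defs
  imports "Jordan_Normal_Form.Schur_Decomposition" "HOL-Library.Extended_Nat"
begin

text \<open>A sequence $(s_j)_{j=0}^\kappa$ of complex $q\times q$ matrices is represented by a function
  \<open>s :: nat \<Rightarrow> complex mat\<close> together with \<open>\<kappa> :: enat\<close>; the values \<open>s j\<close> with
  \<open>j > \<kappa>\<close> carry no meaning.  Every sequence-valued operation below yields at index \<open>j\<close> a
  value that depends only on those entries of its argument from which the mathematical operation
  computes its \<open>j\<close>-th term, so \<open>\<kappa>\<close> is not an argument of these operations.\<close>

definition nonneg_hermitian :: "complex mat \<Rightarrow> bool" where
  "nonneg_hermitian A \<longleftrightarrow> square_mat A \<and> mat_adjoint A = A \<and>
     (\<forall>v \<in> carrier_vec (dim_row A). 0 \<le> (A *\<^sub>v v) \<bullet>c v)"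
  \<comment> \<open>for complex numbers \<open>0 \<le> z\<close> means that \<open>z\<close> is real and nonnegative\<close>

definition is_moore_penrose :: "complex mat \<Rightarrow> complex mat \<Rightarrow> bool" where
  "is_moore_penrose A X \<longleftrightarrow> X \<in> carrier_mat (dim_col A) (dim_row A) \<and>
     A * X * A = A \<and> X * A * X = X \<and>
     mat_adjoint (A * X) = A * X \<and> mat_adjoint (X * A) = X * A"

definition moore_penrose :: "complex mat \<Rightarrow> complex mat" where
  "moore_penrose A = (THE X. is_moore_penrose A X)"

text \<open>Entry \<open>(a, b)\<close> of a block matrix with \<open>q \<times> q\<close> blocks is entry
  \<open>(a mod q, b mod q)\<close> of block \<open>(a div q, b div q)\<close>.\<close>

definition block_hankel :: "nat \<Rightarrow> (nat \<Rightarrow> complex mat) \<Rightarrow> nat \<Rightarrow> complex mat" where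
  "block_hankel q s n = mat (Suc n * q) (Suc n * q)
     (\<lambda>(a, b). s (a div q + b div q) $$ (a mod q, b mod q))"

text \<open>The block row $[s_m, \dots, s_{m+n-1}]$ and the corresponding block column.\<close>

definition block_row :: "nat \<Rightarrow> (nat \<Rightarrow> complex mat) \<Rightarrow> nat \<Rightarrow> nat \<Rightarrow> complex mat" where
  "block_row q s m n = mat q (n * q) (\<lambda>(a, b). s (m + b div q) $$ (a, b mod q))"

definition block_col :: "nat \<Rightarrow> (nat \<Rightarrow> complex mat) \<Rightarrow> nat \<Rightarrow> nat \<Rightarrow> complex mat" where
  "block_col q s m n = mat (n * q) q (\<lambda>(a, b). s (m + a div q) $$ (a mod q, b))"

definition shifted :: "real \<Rightarrow> (nat \<Rightarrow> complex mat) \<Rightarrow> nat \<Rightarrow> complex mat" where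
  "shifted \<alpha> s j = (- complex_of_real \<alpha>) \<cdot>\<^sub>m s j + s (Suc j)"

definition K_ge_fin :: "nat \<Rightarrow> nat \<Rightarrow> real \<Rightarrow> (nat \<Rightarrow> complex mat) set" where
  "K_ge_fin q m \<alpha> = {s. (\<forall>j\<le>m. s j \<in> carrier_mat q q) \<and>
     (m = 0 \<longrightarrow> nonneg_hermitian (s 0)) \<and>
     (\<forall>n\<ge>1. m = 2 * n \<longrightarrow>
        nonneg_hermitian (block_hankel q s n) \<and>
        nonneg_hermitian (block_hankel q (shifted \<alpha> s) (n - 1))) \<and>
     (\<forall>n. m = 2 * n + 1 \<longrightarrow>
        nonneg_hermitian (block_hankel q s n) \<and>
        nonneg_hermitian (block_hankel q (shifted \<alpha> s) n))}"

definition K_ge :: "nat \<Rightarrow> enat \<Rightarrow> real \<Rightarrow> (nat \<Rightarrow> complex mat) set" where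
  "K_ge q \<kappa> \<alpha> = (case \<kappa> of enat m \<Rightarrow> K_ge_fin q m \<alpha> | \<infinity> \<Rightarrow> (\<Inter>m. K_ge_fin q m \<alpha>))"

definition K_ge_e :: "nat \<Rightarrow> enat \<Rightarrow> real \<Rightarrow> (nat \<Rightarrow> complex mat) set" where
  "K_ge_e q \<kappa> \<alpha> = (case \<kappa> of
       enat m \<Rightarrow> {s. \<exists>X \<in> carrier_mat q q. s(Suc m := X) \<in> K_ge q (enat (Suc m)) \<alpha>}
     | \<infinity> \<Rightarrow> K_ge q \<infinity> \<alpha>)"

definition hankel_schur_compl :: "nat \<Rightarrow> (nat \<Rightarrow> complex mat) \<Rightarrow> nat \<Rightarrow> complex mat" where
  "hankel_schur_compl q s n = (if n = 0 then s 0
     else s (2 * n) - block_row q s n n * moore_penrose (block_hankel q s (n - 1)) * block_col q s n n)"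

definition stieltjes_param :: "nat \<Rightarrow> real \<Rightarrow> (nat \<Rightarrow> complex mat) \<Rightarrow> nat \<Rightarrow> complex mat" where
  "stieltjes_param q \<alpha> s j = (if even j then hankel_schur_compl q s (j div 2)
     else hankel_schur_compl q (shifted \<alpha> s) (j div 2))"

definition plus_transform :: "nat \<Rightarrow> real \<Rightarrow> (nat \<Rightarrow> complex mat) \<Rightarrow> nat \<Rightarrow> complex mat" where
  "plus_transform q \<alpha> s j =
     (- complex_of_real \<alpha>) \<cdot>\<^sub>m (if j = 0 then 0\<^sub>m q q else s (j - 1)) + s j"

text \<open>The type of matrices of arbitrary format is no additive monoid, so the sum of matrices in the
  recursion is formed entrywise.\<close>

fun reciprocal :: "nat \<Rightarrow> (nat \<Rightarrow> complex mat) \<Rightarrow> nat \<Rightarrow> complex mat" where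
  "reciprocal q u j = (if j = 0 then moore_penrose (u 0)
     else - moore_penrose (u 0) *
       mat q q (\<lambda>(a, b). \<Sum>l<j. (u (j - l) * reciprocal q u l) $$ (a, b)))"

declare reciprocal.simps [simp del]

definition schur_transform1 :: "nat \<Rightarrow> real \<Rightarrow> (nat \<Rightarrow> complex mat) \<Rightarrow> nat \<Rightarrow> complex mat" where
  "schur_transform1 q \<alpha> s j = - s 0 * reciprocal q (plus_transform q \<alpha> s) (Suc j) * s 0"

definition schur_transform :: "nat \<Rightarrow> real \<Rightarrow> nat \<Rightarrow> (nat \<Rightarrow> complex mat) \<Rightarrow> nat \<Rightarrow> complex mat" where
  "schur_transform q \<alpha> k s = (schur_transform1 q \<alpha> ^^ k) s"

end

theory Submission
  imports Defs "HOL-Computational_Algebra.Formal_Power_Series"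
begin

text \<open>
  Write \<open>S(x) = \<Sum>\<^sub>j s\<^sub>j x\<^sup>j\<close>, let \<open>d\<close> be the Moore--Penrose inverse of \<open>s\<^sub>0\<close> and \<open>P = s\<^sub>0 d\<close> the orthogonal
  projection onto the range of \<open>s\<^sub>0\<close>. Suppose that every \<open>s\<^sub>j\<close> is Hermitian and lives on that range, so
  that \<open>P s\<^sub>j = s\<^sub>j = s\<^sub>j P\<close>. The series \<open>U = (1 - \<alpha> x) S\<close> then has a genuine reciprocal relative to
  \<open>P\<close>, and the first Schur transform \<open>T(x) = \<Sum>\<^sub>j t\<^sub>j x\<^sup>j\<close> is defined so that \<open>V = s\<^sub>0 - x T\<close> satisfies
  \<open>U d V = s\<^sub>0 = V d U\<close>. The factor \<open>1 - \<alpha> x\<close> is central, so with \<open>W = (1 - \<alpha> x) V\<close> also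
  \<open>S d W = s\<^sub>0 = W d S\<close>. The coefficients of \<open>U\<close> and \<open>V\<close> of index \<open>j + 1\<close> are \<open>s\<^bsub>\<alpha>,j\<^esub>\<close> and \<open>- t\<^sub>j\<close>, and
  the coefficient of \<open>W\<close> of index \<open>j + 2\<close> is \<open>- t\<^bsub>\<alpha>,j\<^esub>\<close>.

  Whenever \<open>F d G = s\<^sub>0 = G d F\<close>, the Hankel matrices of \<open>F\<close> and of \<open>- G\<close> determine each other by
  a triangular change of basis. In generating functions of two variables,
  \<open>H\<^sub>F(x,y) = (x F(x) - y F(y)) / (x - y)\<close>, and multiplying by \<open>G(x) d\<close> from the left and by
  \<open>d G(y)\<close> from the right gives \<open>(x G(y) - y G(x)) / (x - y)\<close>, whose coefficients are \<open>s\<^sub>0\<close> in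
  position \<open>(0,0)\<close>, \<open>- g\<^bsub>j+k\<^esub>\<close> for \<open>j, k \<ge> 1\<close>, and \<open>0\<close> elsewhere. The matrices starting at index
  one are compared in the same way, through \<open>(F(x) - F(y)) / (x - y)\<close>. The block Toeplitz factors are
  triangular with diagonal blocks \<open>P\<close>. Hence the congruence preserves nonnegativity, and it leaves the
  last Schur complement unchanged. For \<open>(U, V)\<close>, starting at index one, this compares
  \<open>H\<^bsub>\<alpha>,n\<^esub>\<close> of \<open>s\<close> with \<open>H\<^sub>n\<close> of \<open>t\<close> and gives \<open>Q\<^bsub>2n+1\<^esub>(s) = Q\<^bsub>2n\<^esub>(t)\<close>
  (\<open>transform_shifted_step\<close>). For \<open>(S, W)\<close> it compares \<open>H\<^bsub>n+1\<^esub>\<close> of \<open>s\<close> with \<open>s\<^sub>0 \<oplus> H\<^bsub>\<alpha>,n\<^esub>(t)\<close> and gives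
  \<open>Q\<^bsub>2n+2\<^esub>(s) = Q\<^bsub>2n+1\<^esub>(t)\<close> (\<open>transform_unshifted_step\<close>). So one transform deletes the first
  parameter, and the theorem follows by induction on the number of transforms.

  The induction needs the transform to be extendable again. If \<open>(s\<^sub>j)\<close> is extended by one term
  within the Stieltjes class, nonnegativity of the two Hankel matrices forces the range condition on
  all terms but the last. Replacing every \<open>s\<^sub>j\<close> by \<open>P s\<^sub>j P\<close> therefore changes only the appended term,
  and it keeps both Hankel matrices nonnegative (\<open>regularise\<close>). The transform of the resulting sequence
  is again in the Stieltjes class and extends the transform of the given sequence.

  All computations with blocks and with power series take place in one ring with involution that
  contains the zero-padded matrices of every format. Block matrices are assembled there by partial
  isometries \<open>J\<^sub>k\<close>, and a Schur complement is read off from a solution of the block Hankel system whose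
  last block is \<open>1\<close>.
\<close>

section \<open>The ring of row- and column-finite matrices\<close>

text \<open>The format of a matrix is not part of its type, so matrices themselves form no ring. Infinite
  matrices with finitely many nonzero entries in each row and column do: products are finite sums,
  conjugate transposition is an involution, and there is a unit. Matrices of every
  format, padded by zeros, lie in this one ring.\<close>

typedef rcf = "{f :: nat \<Rightarrow> nat \<Rightarrow> complex.
    (\<forall>i. finite {j. f i j \<noteq> 0}) \<and> (\<forall>j. finite {i. f i j \<noteq> 0})}"
  morphisms entry Rcf
  by (rule exI[of _ "\<lambda>_ _. 0"]) simp

setup_lifting type_definition_rcf

lemma finite_row: "finite {j. entry a i j \<noteq> 0}"
  and finite_col: "finite {i. entry a i j \<noteq> 0}"
  using entry[of a] by auto

lemma rcf_eqI: "(\<And>i j. entry a i j = entry b i j) \<Longrightarrow> a = b"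
  by (metis entry_inject ext)

instantiation rcf :: ring_1
begin

lift_definition zero_rcf :: rcf is "\<lambda>_ _. 0" by simp

lift_definition one_rcf :: rcf is "\<lambda>i j. if i = j then 1 else 0" by auto

lift_definition plus_rcf :: "rcf \<Rightarrow> rcf \<Rightarrow> rcf" is "\<lambda>a b i j. a i j + b i j"
proof -
  fix a b :: "nat \<Rightarrow> nat \<Rightarrow> complex"
  assume a: "(\<forall>i. finite {j. a i j \<noteq> 0}) \<and> (\<forall>j. finite {i. a i j \<noteq> 0})"
    and b: "(\<forall>i. finite {j. b i j \<noteq> 0}) \<and> (\<forall>j. finite {i. b i j \<noteq> 0})"
  have "finite {j. a i j + b i j \<noteq> 0}" for i
    by (rule finite_subset[of _ "{j. a i j \<noteq> 0} \<union> {j. b i j \<noteq> 0}"]) (use a b in auto)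
  moreover have "finite {i. a i j + b i j \<noteq> 0}" for j
    by (rule finite_subset[of _ "{i. a i j \<noteq> 0} \<union> {i. b i j \<noteq> 0}"]) (use a b in auto)
  ultimately show "(\<forall>i. finite {j. a i j + b i j \<noteq> 0}) \<and> (\<forall>j. finite {i. a i j + b i j \<noteq> 0})"
    by simp
qed

lift_definition uminus_rcf :: "rcf \<Rightarrow> rcf" is "\<lambda>a i j. - a i j" by simp

definition minus_rcf :: "rcf \<Rightarrow> rcf \<Rightarrow> rcf" where "a - b = a + - (b :: rcf)"

lift_definition times_rcf :: "rcf \<Rightarrow> rcf \<Rightarrow> rcf" is
  "\<lambda>a b i j. \<Sum>l | a i l \<noteq> 0. a i l * b l j"
proof -
  fix a b :: "nat \<Rightarrow> nat \<Rightarrow> complex"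
  assume a: "(\<forall>i. finite {j. a i j \<noteq> 0}) \<and> (\<forall>j. finite {i. a i j \<noteq> 0})"
    and b: "(\<forall>i. finite {j. b i j \<noteq> 0}) \<and> (\<forall>j. finite {i. b i j \<noteq> 0})"
  let ?c = "\<lambda>i j. \<Sum>l | a i l \<noteq> 0. a i l * b l j"
  have nz: "\<exists>l. a i l \<noteq> 0 \<and> b l j \<noteq> 0" if "?c i j \<noteq> 0" for i j
  proof (rule ccontr)
    assume "\<not> ?thesis"
    hence "?c i j = 0" by (intro sum.neutral) auto
    with that show False by simp
  qed
  have "finite {j. ?c i j \<noteq> 0}" for i
    by (rule finite_subset[of _ "\<Union>l\<in>{l. a i l \<noteq> 0}. {j. b l j \<noteq> 0}"]) (use a b in \<open>auto dest!: nz\<close>)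
  moreover have "finite {i. ?c i j \<noteq> 0}" for j
    by (rule finite_subset[of _ "\<Union>l\<in>{l. b l j \<noteq> 0}. {i. a i l \<noteq> 0}"]) (use a b in \<open>auto dest!: nz\<close>)
  ultimately show "(\<forall>i. finite {j. ?c i j \<noteq> 0}) \<and> (\<forall>j. finite {i. ?c i j \<noteq> 0})"
    by simp
qed

lemma entry_times_row:
  assumes "finite S" "{l. entry a i l \<noteq> 0} \<subseteq> S"
  shows "entry (a * b) i j = (\<Sum>l\<in>S. entry a i l * entry b l j)"
  unfolding times_rcf.rep_eq by (rule sum.mono_neutral_left) (use assms in auto)

text \<open>Products are defined by summing over the support of a row. That one may equally sum over the
  support of a column is what makes associativity an exchange of two finite sums.\<close>

lemma entry_times_col:
  assumes "finite S" "{l. entry b l j \<noteq> 0} \<subseteq> S"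
  shows "entry (a * b) i j = (\<Sum>l\<in>S. entry a i l * entry b l j)"
proof -
  let ?T = "{l. entry a i l \<noteq> 0}"
  have "entry (a * b) i j = (\<Sum>l\<in>?T \<union> S. entry a i l * entry b l j)"
    by (rule entry_times_row) (use assms finite_row in auto)
  also have "\<dots> = (\<Sum>l\<in>S. entry a i l * entry b l j)"
    by (rule sum.mono_neutral_right) (use assms finite_row in auto)
  finally show ?thesis .
qed

lemma entry_plus: "entry (a + b) i j = entry a i j + entry b i j"
  by (simp add: plus_rcf.rep_eq)

instance
proof
  fix a b c :: rcf
  note e = plus_rcf.rep_eq uminus_rcf.rep_eq minus_rcf_def zero_rcf.rep_eq
  show "a + b + c = a + (b + c)" "a + b = b + a" "0 + a = a" "- a + a = 0" "a - b = a + - b"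
    by (auto intro!: rcf_eqI simp: e)
  show "(0 :: rcf) \<noteq> 1"
  proof
    assume "(0 :: rcf) = 1"
    hence "entry 0 0 0 = entry 1 0 0" by simp
    thus False by (simp add: zero_rcf.rep_eq one_rcf.rep_eq)
  qed
  show "1 * a = a"
    by (rule rcf_eqI, subst entry_times_row[of "{_}"], auto simp: one_rcf.rep_eq)
  show "a * 1 = a"
    by (rule rcf_eqI, subst entry_times_col[of "{_}"], auto simp: one_rcf.rep_eq)
  show "a * b * c = a * (b * c)"
  proof (rule rcf_eqI)
    fix i j
    let ?S = "{k. entry a i k \<noteq> 0}" and ?T = "{l. entry c l j \<noteq> 0}"
    have "entry (a * b * c) i j = (\<Sum>l\<in>?T. entry (a * b) i l * entry c l j)"
      by (rule entry_times_col) (auto simp: finite_col)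
    also have "\<dots> = (\<Sum>l\<in>?T. \<Sum>k\<in>?S. entry a i k * entry b k l * entry c l j)"
      by (simp add: entry_times_row[OF finite_row order_refl] sum_distrib_right)
    also have "\<dots> = (\<Sum>k\<in>?S. \<Sum>l\<in>?T. entry a i k * entry b k l * entry c l j)"
      by (rule sum.swap)
    also have "\<dots> = (\<Sum>k\<in>?S. entry a i k * entry (b * c) k j)"
      by (simp add: entry_times_col[OF finite_col order_refl] sum_distrib_left mult.assoc)
    also have "\<dots> = entry (a * (b * c)) i j"
      by (rule entry_times_row[symmetric]) (auto simp: finite_row)
    finally show "entry (a * b * c) i j = entry (a * (b * c)) i j" .
  qed
  show "(a + b) * c = a * c + b * c"
    by (rule rcf_eqI)
      (simp add: entry_times_col[OF finite_col order_refl] entry_plus distrib_right sum.distrib)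
  show "a * (b + c) = a * b + a * c"
    by (rule rcf_eqI)
      (simp add: entry_times_row[OF finite_row order_refl] entry_plus distrib_left sum.distrib)
qed

end

lemma entry_zero [simp]: "entry 0 i j = 0"
  and entry_one: "entry 1 i j = (if i = j then 1 else 0)"
  and entry_uminus [simp]: "entry (- a) i j = - entry a i j"
  and entry_minus [simp]: "entry (a - b) i j = entry a i j - entry b i j"
  by (simp_all add: zero_rcf.rep_eq one_rcf.rep_eq uminus_rcf.rep_eq
      entry_plus[of a "- b", unfolded uminus_rcf.rep_eq, simplified])

declare entry_plus [simp]

lemma entry_sum: "entry (sum f A) i j = (\<Sum>x\<in>A. entry (f x) i j)"
  by (induction A rule: infinite_finite_induct) auto

lift_definition star :: "rcf \<Rightarrow> rcf" is "\<lambda>a i j. cnj (a j i)" by auto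

lift_definition scalar :: "complex \<Rightarrow> rcf" is "\<lambda>c i j. if i = j then c else 0" by auto

lift_definition matrix_unit :: "nat \<Rightarrow> nat \<Rightarrow> rcf" is "\<lambda>i j k l. if k = i \<and> l = j then 1 else 0" by auto

lemma star_star [simp]: "star (star a) = a"
  and star_zero [simp]: "star 0 = 0"
  and star_one [simp]: "star 1 = 1"
  and star_plus [simp]: "star (a + b) = star a + star b"
  and star_uminus [simp]: "star (- a) = - star a"
  and star_minus [simp]: "star (a - b) = star a - star b"
  by (auto intro!: rcf_eqI simp: star.rep_eq entry_one)

lemma star_times [simp]: "star (a * b) = star b * star a"
proof (rule rcf_eqI)
  fix i j
  have "entry (star (a * b)) i j = (\<Sum>l | entry b l i \<noteq> 0. cnj (entry a j l) * cnj (entry b l i))"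
    by (simp add: star.rep_eq entry_times_col[OF finite_col order_refl])
  also have "\<dots> = entry (star b * star a) i j"
    by (subst entry_times_row[OF finite_row order_refl]) (simp add: star.rep_eq mult.commute)
  finally show "entry (star (a * b)) i j = entry (star b * star a) i j" .
qed

lemma star_sum [simp]: "star (sum f A) = (\<Sum>x\<in>A. star (f x))"
  by (induction A rule: infinite_finite_induct) auto

lemma entry_scalar_times [simp]: "entry (scalar c * a) i j = c * entry a i j"
  by (subst entry_times_row[of "{i}"]) (auto simp: scalar.rep_eq)

lemma entry_times_scalar [simp]: "entry (a * scalar c) i j = c * entry a i j"
  by (subst entry_times_col[of "{j}"]) (auto simp: scalar.rep_eq)

lemma scalar_commute: "a * scalar c = scalar c * a"
  by (rule rcf_eqI) simp

lemma star_scalar [simp]: "star (scalar c) = scalar (cnj c)"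
  by (rule rcf_eqI) (simp add: star.rep_eq scalar.rep_eq)

lemma scalar_times_scalar: "scalar c * scalar d = scalar (c * d)"
  by (rule rcf_eqI) (auto simp: scalar.rep_eq)

lemma scalar_one [simp]: "scalar 1 = 1" and scalar_uminus: "scalar (- c) = - scalar c"
  by (auto intro!: rcf_eqI simp: scalar.rep_eq entry_one)

text \<open>The diagonal entries of \<open>star a * a\<close> are the squared lengths of the columns of \<open>a\<close>.\<close>

lemma star_self_eq_0: "a = 0" if "star a * a = 0"
proof (rule rcf_eqI)
  fix i j
  have "(\<Sum>l | entry a l j \<noteq> 0. cnj (entry a l j) * entry a l j) = entry (star a * a) j j"
    by (subst entry_times_col[OF finite_col order_refl]) (simp add: star.rep_eq)
  also have "\<dots> = 0" by (simp add: that)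
  finally have "(\<Sum>l | entry a l j \<noteq> 0. complex_of_real ((cmod (entry a l j))\<^sup>2)) = 0"
    by (simp only: complex_norm_square mult.commute[of "cnj _"])
  hence "(\<Sum>l | entry a l j \<noteq> 0. (cmod (entry a l j))\<^sup>2) = 0"
    by (simp flip: of_real_sum del: of_real_power)
  hence "\<forall>l\<in>{l. entry a l j \<noteq> 0}. (cmod (entry a l j))\<^sup>2 = 0"
    by (subst (asm) sum_nonneg_eq_0_iff) (auto simp: finite_col)
  thus "entry a i j = entry 0 i j" by auto
qed

text \<open>A vector is represented by column \<open>0\<close> of a ring element, so a quadratic form is evaluated at entry
  \<open>(0, 0)\<close>. With matrix units in place of the two vectors this recovers all entries.\<close>

lemma entry_matrix_unit_conj: "entry (star (matrix_unit i 0) * a * matrix_unit j 0) 0 0 = entry a i j"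
proof -
  have "entry (b * matrix_unit j 0) k 0 = entry b k j" for b k
    by (subst entry_times_col[of "{j}"]) (auto simp: matrix_unit.rep_eq)
  moreover have "entry (star (matrix_unit i 0) * a) 0 j = entry a i j"
    by (subst entry_times_row[of "{i}"]) (auto simp: matrix_unit.rep_eq star.rep_eq)
  ultimately show ?thesis by simp
qed

section \<open>Embedding matrices by zero padding\<close>

lift_definition emb :: "complex mat \<Rightarrow> rcf" is
  "\<lambda>A i j. if i < dim_row A \<and> j < dim_col A then A $$ (i, j) else 0"
proof -
  fix A :: "complex mat"
  let ?f = "\<lambda>i j. if i < dim_row A \<and> j < dim_col A then A $$ (i, j) else 0"
  have "finite {j. ?f i j \<noteq> 0}" for i
    by (rule finite_subset[of _ "{..<dim_col A}"]) auto
  moreover have "finite {i. ?f i j \<noteq> 0}" for j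
    by (rule finite_subset[of _ "{..<dim_row A}"]) auto
  ultimately show "(\<forall>i. finite {j. ?f i j \<noteq> 0}) \<and> (\<forall>j. finite {i. ?f i j \<noteq> 0})"
    by simp
qed

lemmas entry_emb = emb.rep_eq

lemma emb_inject:
  assumes "A \<in> carrier_mat n m" "B \<in> carrier_mat n m" "emb A = emb B"
  shows "A = B"
proof (rule eq_matI)
  fix i j assume ij: "i < dim_row B" "j < dim_col B"
  have "entry (emb A) i j = entry (emb B) i j" by (simp only: assms(3))
  thus "A $$ (i, j) = B $$ (i, j)" using assms(1,2) ij by (simp add: entry_emb)
qed (use assms in auto)

lemma emb_mult: "dim_col A = dim_row B \<Longrightarrow> emb (A * B) = emb A * emb B"
  by (rule rcf_eqI, subst entry_times_row[of "{..<dim_col A}"])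
    (auto simp: entry_emb scalar_prod_def atLeast0LessThan split: if_splits intro!: sum.cong)

lemma emb_add: "A \<in> carrier_mat n m \<Longrightarrow> B \<in> carrier_mat n m \<Longrightarrow> emb (A + B) = emb A + emb B"
  and emb_minus: "A \<in> carrier_mat n m \<Longrightarrow> B \<in> carrier_mat n m \<Longrightarrow> emb (A - B) = emb A - emb B"
  and emb_uminus: "emb (- A) = - emb A"
  and emb_smult: "emb (c \<cdot>\<^sub>m A) = scalar c * emb A"
  and emb_zero: "emb (0\<^sub>m n m) = 0"
  by (auto intro!: rcf_eqI simp: entry_emb)

lemma mat_adjoint_carrier: "A \<in> carrier_mat n m \<Longrightarrow> mat_adjoint A \<in> carrier_mat m n"
  by (auto simp: mat_adjoint_def)

lemma emb_mat_adjoint: "emb (mat_adjoint A) = star (emb A)"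
  by (rule rcf_eqI) (auto simp: entry_emb star.rep_eq mat_adjoint_def mat_of_rows_def)

definition idn :: "nat \<Rightarrow> rcf" where "idn n = emb (1\<^sub>m n)"

lemma entry_idn: "entry (idn n) i j = (if i = j \<and> i < n then 1 else 0)"
  by (auto simp: idn_def entry_emb)

lemma entry_idn_times: "entry (idn n * a) i j = (if i < n then entry a i j else 0)"
  by (subst entry_times_row[of "{i}"]) (auto simp: entry_idn split: if_splits)

lemma entry_times_idn: "entry (a * idn n) i j = (if j < n then entry a i j else 0)"
  by (subst entry_times_col[of "{j}"]) (auto simp: entry_idn split: if_splits)

lemma star_idn [simp]: "star (idn n) = idn n"
  by (rule rcf_eqI) (auto simp: star.rep_eq entry_idn)

lemma idn_emb: "A \<in> carrier_mat n m \<Longrightarrow> idn n * emb A = emb A"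
  and emb_idn: "A \<in> carrier_mat n m \<Longrightarrow> emb A * idn m = emb A"
  by (auto intro!: rcf_eqI simp: entry_idn_times entry_times_idn entry_emb)

definition corner :: "nat \<Rightarrow> nat \<Rightarrow> rcf \<Rightarrow> complex mat" where
  "corner n m a = mat n m (\<lambda>(i, j). entry a i j)"

lemma corner_carrier [simp]: "corner n m a \<in> carrier_mat n m"
  by (simp add: corner_def)

lemma emb_corner: "emb (corner n m a) = idn n * a * idn m"
  by (rule rcf_eqI) (auto simp: entry_emb corner_def entry_idn_times entry_times_idn)

text \<open>A vector \<open>v\<close> corresponds to the padded one-column matrix \<open>x\<close>, and conversely the part of
  column \<open>0\<close> of any \<open>x\<close> outside the format of \<open>A\<close> does not contribute to the form.\<close>

lemma nonneg_hermitian_iff: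
  "nonneg_hermitian A \<longleftrightarrow> square_mat A \<and> star (emb A) = emb A \<and>
     (\<forall>x. 0 \<le> entry (star x * emb A * x) 0 0)"
proof (cases "square_mat A")
  case True
  define n where "n = dim_row A"
  have A: "A \<in> carrier_mat n n" using True by (auto simp: n_def)
  have form: "entry (star x * emb A * x) 0 0 = (\<Sum>i<n. (\<Sum>j<n. A $$ (i, j) * entry x j 0) * cnj (entry x i 0))"
    for x
  proof -
    have *: "idn n * emb A = emb A" "emb A * idn n = emb A" using idn_emb emb_idn A by auto
    have "entry (emb A * x) i 0 = (\<Sum>j<n. entry (emb A) i j * entry x j 0)" for i
      by (rule entry_times_row) (use A in \<open>auto simp: entry_emb\<close>)
    moreover have "entry (star x * (emb A * x)) 0 0 =
        (\<Sum>i<n. cnj (entry x i 0) * entry (emb A * x) i 0)"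
    proof -
      have "idn n * (emb A * x) = emb A * x" by (simp add: * flip: mult.assoc)
      hence "entry (emb A * x) l 0 = 0" if "\<not> l < n" for l
        by (metis entry_idn_times that)
      hence "{l. entry (emb A * x) l 0 \<noteq> 0} \<subseteq> {..<n}" by blast
      thus ?thesis by (subst entry_times_col[of "{..<n}"]) (auto simp: star.rep_eq)
    qed
    ultimately show ?thesis using A
      by (auto simp: mult.assoc entry_emb mult.commute intro!: sum.cong)
  qed
  have form2: "(A *\<^sub>v v) \<bullet>c v = (\<Sum>i<n. (\<Sum>j<n. A $$ (i, j) * v $ j) * cnj (v $ i))"
    if "v \<in> carrier_vec n" for v
    using that A by (auto simp: scalar_prod_def mult_mat_vec_def atLeast0LessThan intro!: sum.cong)
  have "(\<forall>v \<in> carrier_vec n. 0 \<le> (A *\<^sub>v v) \<bullet>c v) \<longleftrightarrow> (\<forall>x. 0 \<le> entry (star x * emb A * x) 0 0)"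
  proof safe
    fix x assume *: "\<forall>v \<in> carrier_vec n. 0 \<le> (A *\<^sub>v v) \<bullet>c v"
    let ?v = "vec n (\<lambda>i. entry x i 0)"
    have "entry (star x * emb A * x) 0 0 = (A *\<^sub>v ?v) \<bullet>c ?v"
      by (subst form, subst form2) auto
    thus "0 \<le> entry (star x * emb A * x) 0 0" using * by simp
  next
    fix v :: "complex vec" assume *: "\<forall>x. 0 \<le> entry (star x * emb A * x) 0 0" and v: "v \<in> carrier_vec n"
    let ?x = "emb (mat n 1 (\<lambda>(i, j). v $ i))"
    have "entry (star ?x * emb A * ?x) 0 0 = (A *\<^sub>v v) \<bullet>c v"
      by (subst form, subst form2) (use v in \<open>auto simp: entry_emb\<close>)
    thus "0 \<le> (A *\<^sub>v v) \<bullet>c v" using * by metis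
  qed
  moreover have "mat_adjoint A = A \<longleftrightarrow> star (emb A) = emb A"
    using emb_inject[OF mat_adjoint_carrier[OF A] A] by (auto simp: emb_mat_adjoint[symmetric])
  ultimately show ?thesis using True by (simp add: nonneg_hermitian_def n_def)
qed (simp add: nonneg_hermitian_def)

section \<open>Moore--Penrose inverses of Hermitian matrices\<close>

definition mp_inverse :: "rcf \<Rightarrow> rcf \<Rightarrow> bool" where
  "mp_inverse a x \<longleftrightarrow> a * x * a = a \<and> x * a * x = x \<and> star (a * x) = a * x \<and> star (x * a) = x * a"

lemma mp_inverse_unique:
  assumes "mp_inverse a x" "mp_inverse a y"
  shows "x = y"
proof -
  have 1: "a * x = a * y"
  proof -
    have "a * x = star (a * x)" using assms by (simp add: mp_inverse_def)
    also have "\<dots> = star (a * y * a * x)" using assms by (simp add: mp_inverse_def)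
    also have "\<dots> = star (a * x) * star (a * y)" by (simp add: mult.assoc)
    also have "\<dots> = (a * x) * (a * y)" using assms by (simp add: mp_inverse_def del: star_times)
    also have "\<dots> = (a * x * a) * y" by (simp only: mult.assoc)
    also have "\<dots> = a * y" using assms by (simp add: mp_inverse_def)
    finally show ?thesis .
  qed
  have 2: "x * a = y * a"
  proof -
    have "x * a = star (x * a)" using assms by (simp add: mp_inverse_def)
    also have "\<dots> = star (x * (a * y * a))" using assms by (simp add: mp_inverse_def)
    also have "\<dots> = star (y * a) * star (x * a)" by (simp add: mult.assoc)
    also have "\<dots> = (y * a) * (x * a)" using assms by (simp add: mp_inverse_def del: star_times)
    also have "\<dots> = y * (a * x * a)" by (simp only: mult.assoc)
    also have "\<dots> = y * a" using assms by (simp add: mp_inverse_def)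
    finally show ?thesis .
  qed
  have "x = x * a * x" using assms by (simp add: mp_inverse_def)
  also have "\<dots> = y * a * y" using 1 2 by (simp add: mult.assoc)
  also have "\<dots> = y" using assms by (simp add: mp_inverse_def)
  finally show ?thesis .
qed

text \<open>The adjoint of \<open>x\<close> is a Moore--Penrose inverse of \<open>star a = a\<close> as well.\<close>

lemma mp_inverse_hermitian:
  assumes "mp_inverse a x" "star a = a"
  shows "star x = x" "x * a = a * x"
proof -
  have "mp_inverse a (star x)"
    using assms arg_cong[of _ _ star] unfolding mp_inverse_def
    by (metis star_star star_times mult.assoc)
  thus x: "star x = x" using assms(1) mp_inverse_unique by blast
  have "star (a * x) = a * x" using assms(1) by (simp add: mp_inverse_def)
  thus "x * a = a * x" by (simp add: x assms(2))
qed

lemma is_moore_penrose_iff: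
  "is_moore_penrose A X \<longleftrightarrow> X \<in> carrier_mat (dim_col A) (dim_row A) \<and> mp_inverse (emb A) (emb X)"
proof (cases "X \<in> carrier_mat (dim_col A) (dim_row A)")
  case X: True
  have A: "A \<in> carrier_mat (dim_row A) (dim_col A)" by simp
  note c = mult_carrier_mat[OF A X] mult_carrier_mat[OF X A]
  have *: "(B = C) = (emb B = emb C)" if "B \<in> carrier_mat n m" "C \<in> carrier_mat n m" for n m B C
    using emb_inject that by blast
  show ?thesis unfolding is_moore_penrose_def mp_inverse_def
    using X *[OF mult_carrier_mat[OF c(1) A] A] *[OF mult_carrier_mat[OF c(2) X] X]
      *[OF mat_adjoint_carrier[OF c(1)] c(1)] *[OF mat_adjoint_carrier[OF c(2)] c(2)]
    by (simp add: emb_mat_adjoint emb_mult del: star_times)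
qed (simp add: is_moore_penrose_def)

text \<open>A Hermitian element has no generalized null vectors: \<open>a\<^sup>2 z = 0\<close> gives
  \<open>(a z)\<^sup>* (a z) = z\<^sup>* a\<^sup>2 z = 0\<close>.\<close>

lemma star_self_cancel:
  assumes "star a = a" "a * (a * z) = 0"
  shows "a * z = 0"
proof -
  have "star (a * z) * (a * z) = star z * (a * (a * z))" by (simp add: assms(1) mult.assoc)
  thus ?thesis using assms(2) star_self_eq_0[of "a * z"] by simp
qed

lemma star_power_cancel:
  assumes "star a = a" "a ^ Suc k * z = 0"
  shows "a * z = 0"
  using assms(2)
proof (induction k)
  case (Suc k)
  have "a * (a * (a ^ k * z)) = 0" using Suc.prems by (simp add: mult.assoc)
  from star_self_cancel[OF assms(1) this] show ?case by (intro Suc.IH) (simp add: mult.assoc)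
qed simp

text \<open>The powers of \<open>A\<close> with exponents \<open>1, \<dots>, n\<^sup>2 + 1\<close> lie in a space of dimension \<open>n\<^sup>2\<close>. Written as the
  columns of a square matrix with an additional zero row, they have determinant zero, and a
  null vector is a linear relation among them.\<close>

lemma powers_dependent:
  assumes A: "A \<in> carrier_mat n n"
  shows "\<exists>v k. v k \<noteq> (0::complex) \<and> k \<le> n * n \<and> (\<Sum>c\<le>n*n. scalar (v c) * emb A ^ Suc c) = 0"
proof -
  let ?m = "Suc (n * n)"
  have supp: "entry (emb A ^ Suc c) i j = (if i < n \<and> j < n then entry (emb A ^ Suc c) i j else 0)" for c i j
  proof -
    have "idn n * emb A ^ Suc c * idn n = emb A ^ Suc c"
    proof -
      have "emb A ^ Suc c * idn n = emb A ^ Suc c"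
        by (simp add: power_Suc2 mult.assoc emb_idn[OF A] del: power_Suc)
      moreover have "idn n * emb A ^ Suc c = emb A ^ Suc c"
        by (simp add: idn_emb[OF A] flip: mult.assoc)
      ultimately show ?thesis by simp
    qed
    from arg_cong[OF this, of "\<lambda>x. entry x i j"] show ?thesis
      unfolding entry_times_idn entry_idn_times by (auto split: if_splits)
  qed
  define B where "B = mat ?m ?m (\<lambda>(r, c). if r < n * n then entry (emb A ^ Suc c) (r div n) (r mod n) else 0)"
  have B: "B \<in> carrier_mat ?m ?m" by (simp add: B_def)
  have "det B = 0"
    using laplace_expansion_row[OF B, of "n * n"] by (simp add: B_def)
  then obtain w where w: "w \<in> carrier_vec ?m" "w \<noteq> 0\<^sub>v ?m" "B *\<^sub>v w = 0\<^sub>v ?m"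
    using det_0_iff_vec_prod_zero[OF B] by auto
  from w(1,2) obtain k where k: "k < ?m" "w $ k \<noteq> 0" by (auto simp: vec_eq_iff)
  have "(\<Sum>c\<le>n*n. scalar (w $ c) * emb A ^ Suc c) = 0"
  proof (rule rcf_eqI)
    fix i j
    show "entry (\<Sum>c\<le>n*n. scalar (w $ c) * emb A ^ Suc c) i j = entry 0 i j"
    proof (cases "i < n \<and> j < n")
      case False
      hence "entry (emb A ^ Suc c) i j = 0" for c by (subst supp) auto
      thus ?thesis by (simp add: entry_sum del: power_Suc)
    next
      case True
      let ?r = "i * n + j"
      have "?r < (i + 1) * n" using True by simp
      also have "\<dots> \<le> n * n" using True by (intro mult_right_mono) auto
      finally have r: "?r < n * n" .
      have "(B *\<^sub>v w) $ ?r = (\<Sum>c\<le>n*n. w $ c * entry (emb A ^ Suc c) i j)"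
        using w(1) r True
        by (auto simp: B_def scalar_prod_def atLeast0LessThan lessThan_Suc_atMost intro!: sum.cong)
      moreover have "(B *\<^sub>v w) $ ?r = 0" using w(3) r by simp
      ultimately show ?thesis by (simp add: entry_sum del: power_Suc)
    qed
  qed
  thus ?thesis using k by (intro exI[of _ "\<lambda>c. w $ c"] exI[of _ k]) auto
qed

text \<open>Such a relation expresses its lowest power of \<open>A\<close> as the next power times a polynomial in \<open>A\<close>. As
  powers of a Hermitian matrix can be cancelled down to the first one, \<open>A\<close> itself is \<open>A\<^sup>2 y\<close>.\<close>

lemma hermitian_square_factor:
  assumes A: "A \<in> carrier_mat n n" and h: "star (emb A) = emb A"
  shows "\<exists>y. emb A = emb A * emb A * y"
proof -
  let ?a = "emb A"
  obtain v k0 where "v k0 \<noteq> (0::complex)" "k0 \<le> n * n"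
    and sum0: "(\<Sum>c\<le>n*n. scalar (v c) * ?a ^ Suc c) = 0"
    using powers_dependent[OF A] by blast
  define k where "k = (LEAST k. v k \<noteq> 0)"
  have k: "v k \<noteq> 0" "k \<le> n * n" and least: "\<And>c. c < k \<Longrightarrow> v c = 0"
    unfolding k_def using LeastI[of "\<lambda>k. v k \<noteq> 0", OF \<open>v k0 \<noteq> 0\<close>] not_less_Least
      Least_le[of "\<lambda>k. v k \<noteq> 0", OF \<open>v k0 \<noteq> 0\<close>] \<open>k0 \<le> n * n\<close> by fastforce+
  define C where "C = (\<Sum>c\<in>{k<..n*n}. scalar (v c) * ?a ^ (c - Suc k))"
  have scalar_0: "scalar 0 = 0" by (rule rcf_eqI) (simp add: scalar.rep_eq)
  have zero: "\<forall>c \<in> {..n*n} - insert k {k<..n*n}. scalar (v c) * ?a ^ Suc c = 0"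
  proof
    fix c assume "c \<in> {..n*n} - insert k {k<..n*n}"
    hence "c < k" by auto
    thus "scalar (v c) * ?a ^ Suc c = 0" by (simp add: least scalar_0)
  qed
  have "(\<Sum>c\<le>n*n. scalar (v c) * ?a ^ Suc c) = (\<Sum>c\<in>insert k {k<..n*n}. scalar (v c) * ?a ^ Suc c)"
    by (rule sum.mono_neutral_right[OF _ _ zero]) (use k in auto)
  also have "\<dots> = scalar (v k) * ?a ^ Suc k + (\<Sum>c\<in>{k<..n*n}. scalar (v c) * ?a ^ Suc c)"
    by simp
  also have "(\<Sum>c\<in>{k<..n*n}. scalar (v c) * ?a ^ Suc c) = ?a ^ Suc k * (?a * C)"
    unfolding C_def sum_distrib_left
  proof (rule sum.cong[OF refl])
    fix c assume "c \<in> {k<..n*n}"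
    hence "Suc c = Suc k + Suc (c - Suc k)" by auto
    hence "?a ^ Suc c = ?a ^ Suc k * (?a * ?a ^ (c - Suc k))"
      by (metis power_add power_Suc)
    thus "scalar (v c) * ?a ^ Suc c = ?a ^ Suc k * (?a * (scalar (v c) * ?a ^ (c - Suc k)))"
      by (simp only: mult.assoc[symmetric] scalar_commute)
  qed
  finally have "?a ^ Suc k * (scalar (v k) + ?a * C) = 0"
    by (simp only: sum0 distrib_left scalar_commute)
  hence "?a * (scalar (v k) + ?a * C) = 0" by (rule star_power_cancel[OF h])
  hence "?a * (scalar (v k) + ?a * C) * scalar (inverse (v k)) = 0" by simp
  hence "?a + ?a * ?a * (C * scalar (inverse (v k))) = 0"
    using k by (simp add: distrib_left distrib_right mult.assoc scalar_times_scalar)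
  hence "?a = ?a * ?a * (- (C * scalar (inverse (v k))))"
    by (simp add: eq_neg_iff_add_eq_0)
  thus ?thesis by blast
qed

text \<open>If \<open>a = a\<^sup>2 y\<close> with \<open>a\<close> Hermitian, taking adjoints gives \<open>a = y\<^sup>* a\<^sup>2\<close> and hence
  \<open>y\<^sup>* a = y\<^sup>* a\<^sup>2 y = a y\<close>. So \<open>a y\<close> is the Hermitian projection onto the range of \<open>a\<close>, and \<open>y\<^sup>* a y\<close> is the
  Moore--Penrose inverse.\<close>

lemma moore_penrose_hermitian:
  assumes A: "A \<in> carrier_mat n n" and h: "star (emb A) = emb A"
  shows "moore_penrose A \<in> carrier_mat n n" "mp_inverse (emb A) (emb (moore_penrose A))"
proof -
  let ?a = "emb A"
  obtain y where y: "?a = ?a * ?a * y" using hermitian_square_factor[OF A h] by blast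
  let ?z = "star y"
  have y': "?z * ?a * ?a = ?a"
    using arg_cong[OF y, of star] h by (simp add: mult.assoc)
  have comm: "?z * ?a = ?a * y"
  proof -
    have "?z * ?a = ?z * ?a * ?a * y" by (subst y) (simp only: mult.assoc)
    thus ?thesis by (simp only: y')
  qed
  define x where "x = ?z * ?a * y"
  have ax: "?a * x = ?a * y"
  proof -
    have "?a * x = ?a * ?a * y * y" by (simp add: x_def comm mult.assoc)
    thus ?thesis by (simp only: y[symmetric])
  qed
  have aya: "?a * y * ?a = ?a" by (simp add: y' flip: comm)
  have xa: "x * ?a = ?a * y"
  proof -
    have "x * ?a = ?z * (?a * y * ?a)" by (simp add: x_def mult.assoc)
    thus ?thesis by (simp only: aya comm)
  qed
  have aza: "?a * ?z * ?a = ?a"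
    using arg_cong[OF aya, of star] h by (simp add: mult.assoc)
  have "mp_inverse ?a x"
    unfolding mp_inverse_def
  proof (intro conjI)
    show "?a * x * ?a = ?a" by (simp add: ax aya)
    have "x * ?a * x = ?z * (?a * ?z * ?a) * y"
      by (simp add: xa flip: comm) (simp add: x_def mult.assoc)
    thus "x * ?a * x = x" by (simp add: aza x_def)
    show "star (?a * x) = ?a * x" unfolding ax by (simp add: h comm)
    show "star (x * ?a) = x * ?a" unfolding xa by (simp add: h comm)
  qed
  moreover have "emb (corner n n x) = x"
  proof -
    have 1: "idn n * x = x"
    proof -
      have "x = ?a * (y * y)" by (simp add: x_def comm mult.assoc)
      thus ?thesis using idn_emb[OF A] by (simp add: mult.assoc[symmetric])
    qed
    have 2: "x * idn n = x"
    proof -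
      have "x = ?z * ?z * ?a" by (simp add: x_def mult.assoc flip: comm)
      thus ?thesis using emb_idn[OF A] by (simp add: mult.assoc)
    qed
    show ?thesis by (simp add: emb_corner 1 2)
  qed
  ultimately have ex: "is_moore_penrose A (corner n n x)"
    using A by (auto simp: is_moore_penrose_iff)
  have "X = corner n n x" if X: "is_moore_penrose A X" for X
  proof (rule emb_inject[of _ n n])
    show "X \<in> carrier_mat n n" using X A by (simp add: is_moore_penrose_iff)
    show "emb X = emb (corner n n x)"
      by (rule mp_inverse_unique[of ?a]) (use X ex in \<open>simp_all only: is_moore_penrose_iff\<close>)
  qed simp
  hence "moore_penrose A = corner n n x"
    unfolding moore_penrose_def by (rule the_equality[of "is_moore_penrose A", OF ex])
  with ex A show "moore_penrose A \<in> carrier_mat n n" "mp_inverse (emb A) (emb (moore_penrose A))"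
    by (auto simp: is_moore_penrose_iff)
qed

section \<open>Block Hankel matrices and their quadratic forms\<close>

text \<open>The partial isometry \<open>J\<^sub>k\<close> that moves coordinate \<open>j < q\<close> to coordinate \<open>k * q + j\<close>. The block matrix
  with blocks \<open>A\<^sub>j\<^sub>k\<close> is the sum of all \<open>J\<^sub>j A\<^sub>j\<^sub>k J\<^sub>k\<^sup>*\<close>, so block calculations become identities in the
  ring.\<close>

lift_definition blk :: "nat \<Rightarrow> nat \<Rightarrow> rcf" is
  "\<lambda>q k i j. if i = k * q + j \<and> j < q then 1 else 0"
proof -
  fix q k :: nat
  have "finite {j. (if i = k * q + j \<and> j < q then 1 else 0 :: complex) \<noteq> 0}" for i
    by (rule finite_subset[of _ "{..<q}"]) auto
  moreover have "finite {i. (if i = k * q + j \<and> j < q then 1 else 0 :: complex) \<noteq> 0}" for j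
    by (rule finite_subset[of _ "{k * q + j}"]) auto
  ultimately show "(\<forall>i. finite {j. (if i = k * q + j \<and> j < q then 1 else 0 :: complex) \<noteq> 0}) \<and>
      (\<forall>j. finite {i. (if i = k * q + j \<and> j < q then 1 else 0 :: complex) \<noteq> 0})"
    by blast
qed

lemma entry_blk: "0 < q \<Longrightarrow> entry (blk q k) i j = (if i div q = k \<and> j = i mod q then 1 else 0)"
  by (auto simp: blk.rep_eq)

lemma entry_blk_times:
  assumes "0 < q"
  shows "entry (blk q k * a) i j = (if i div q = k then entry a (i mod q) j else 0)"
  by (subst entry_times_row[of "{i mod q}"]) (use assms in \<open>auto simp: entry_blk split: if_splits\<close>)

lemma entry_times_star_blk:
  assumes "0 < q"
  shows "entry (a * star (blk q k)) i j = (if j div q = k then entry a i (j mod q) else 0)"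
  by (subst entry_times_col[of "{j mod q}"])
    (use assms in \<open>auto simp: entry_blk star.rep_eq split: if_splits\<close>)

lemma entry_star_blk_times:
  assumes "0 < q"
  shows "entry (star (blk q k) * a) i j = (if i < q then entry a (k * q + i) j else 0)"
  by (subst entry_times_row[of "{k * q + i}"])
    (use assms in \<open>auto simp: blk.rep_eq star.rep_eq split: if_splits\<close>)

lemma star_blk_blk:
  assumes "0 < q"
  shows "star (blk q j) * blk q k = (if j = k then idn q else 0)"
  by (rule rcf_eqI) (use assms in \<open>auto simp: entry_star_blk_times entry_blk entry_idn\<close>)

lemma star_blk_blk_times:
  assumes "0 < q"
  shows "star (blk q j) * (blk q k * a) = (if j = k then idn q * a else 0)"
  by (simp add: star_blk_blk[OF assms] flip: mult.assoc)

definition hermitian_upto :: "(nat \<Rightarrow> rcf) \<Rightarrow> nat \<Rightarrow> bool" where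
  "hermitian_upto h n \<longleftrightarrow> (\<forall>j\<le>n. star (h j) = h j)"

definition hankel_form :: "(nat \<Rightarrow> rcf) \<Rightarrow> nat \<Rightarrow> (nat \<Rightarrow> rcf) \<Rightarrow> rcf" where
  "hankel_form h n p = (\<Sum>j\<le>n. \<Sum>k\<le>n. star (p j) * h (j + k) * p k)"

definition hankel_nonneg :: "(nat \<Rightarrow> rcf) \<Rightarrow> nat \<Rightarrow> bool" where
  "hankel_nonneg h n \<longleftrightarrow> (\<forall>p. 0 \<le> entry (hankel_form h n p) 0 0)"

lemma hankel_form_times: "hankel_form h n (\<lambda>k. p k * y) = star y * hankel_form h n p * y"
  by (simp add: hankel_form_def sum_distrib_left sum_distrib_right mult.assoc)

lemma hankel_form_cong: "(\<And>j. j \<le> 2 * n \<Longrightarrow> h j = h' j) \<Longrightarrow> hankel_form h n = hankel_form h' n"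
  by (auto simp: hankel_form_def fun_eq_iff intro!: sum.cong)

lemma hankel_nonneg_mono:
  assumes "hankel_nonneg h n" "m \<le> n"
  shows "hankel_nonneg h m"
  unfolding hankel_nonneg_def
proof
  fix p :: "nat \<Rightarrow> rcf"
  let ?p = "\<lambda>k. if k \<le> m then p k else 0"
  have "hankel_form h n ?p = (\<Sum>j\<le>m. \<Sum>k\<le>n. star (?p j) * h (j + k) * ?p k)"
    unfolding hankel_form_def by (rule sum.mono_neutral_right) (use assms in auto)
  also have "\<dots> = (\<Sum>j\<le>m. \<Sum>k\<le>m. star (?p j) * h (j + k) * ?p k)"
    by (intro sum.cong[OF refl] sum.mono_neutral_right) (use assms in auto)
  also have "\<dots> = hankel_form h m p" unfolding hankel_form_def by (intro sum.cong refl) auto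
  finally show "0 \<le> entry (hankel_form h m p) 0 0" using assms(1) unfolding hankel_nonneg_def by metis
qed

text \<open>For \<open>c\<close> a sufficiently large negative multiple of the conjugate of \<open>z\<close> the expression would be
  negative.\<close>

lemma complex_affine_nonneg:
  assumes "\<And>c. 0 \<le> cnj c * cnj z + c * z + d" "0 \<le> (d :: complex)"
  shows "z = 0"
proof (rule ccontr)
  assume "z \<noteq> 0"
  hence z: "(cmod z)\<^sup>2 > 0" by simp
  define r where "r = (Re d + 1) / (cmod z)\<^sup>2"
  define c where "c = - of_real r * cnj z"
  have "Re (c * z) = - r * (cmod z)\<^sup>2"
    unfolding cmod_power2 c_def by (simp add: algebra_simps power2_eq_square)
  also have "\<dots> = - (Re d + 1)" using z by (simp add: r_def)
  finally have "Re (c * z) = - (Re d + 1)" .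
  moreover have "Re (cnj c * cnj z) = Re (c * z)" by simp
  moreover have "Re (cnj c * cnj z + c * z + d) = Re (cnj c * cnj z) + Re (c * z) + Re d"
    by (simp only: plus_complex.sel)
  moreover have "0 \<le> Re (cnj c * cnj z + c * z + d)" "0 \<le> Re d"
    using assms(1)[of c] assms(2) by (simp_all only: less_eq_complex_def zero_complex.sel)
  ultimately show False by linarith
qed

text \<open>The mixed terms are row \<open>i\<close> of the Hankel matrix applied to \<open>p\<close>, so nonnegativity of the form gives
  access to single rows.\<close>

lemma hankel_form_perturb:
  fixes p :: "nat \<Rightarrow> rcf" and w :: rcf
  assumes h: "hermitian_upto h (2 * n)" and i: "i \<le> n"
  defines "g \<equiv> \<Sum>k\<le>n. h (i + k) * p k"
  shows "hankel_form h n (\<lambda>k. p k + (if k = i then w else 0)) =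
    hankel_form h n p + star g * w + star w * g + star w * h (i + i) * w"
proof -
  have "hankel_form h n (\<lambda>k. p k + (if k = i then w else 0)) =
      (\<Sum>j\<le>n. \<Sum>k\<le>n. star (p j) * h (j + k) * p k + (if k = i then star (p j) * h (j + i) * w else 0)
        + (if j = i then star w * h (i + k) * p k else 0)
        + (if j = i then if k = i then star w * h (i + i) * w else 0 else 0))"
    unfolding hankel_form_def by (intro sum.cong) (auto simp: algebra_simps)
  also have "\<dots> = hankel_form h n p + (\<Sum>j\<le>n. star (p j) * h (j + i) * w) + star w * g + star w * h (i + i) * w"
  proof -
    have if_sum: "(\<Sum>k\<le>n. if b then f k else 0) = (if b then \<Sum>k\<le>n. f k else 0)"
      for b and f :: "nat \<Rightarrow> rcf" by simp
    show ?thesis using i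
      by (simp add: sum.distrib if_sum hankel_form_def g_def sum_distrib_left mult.assoc)
  qed
  also have "(\<Sum>j\<le>n. star (p j) * h (j + i) * w) = star g * w"
    using h i by (auto simp: g_def hermitian_upto_def sum_distrib_right add.commute intro!: sum.cong)
  finally show ?thesis .
qed

text \<open>The Cauchy--Schwarz argument: if the form vanishes at \<open>p\<close>, then perturbing a large multiple of
  \<open>p\<close> by a fixed vector would make the form negative unless the mixed term vanishes. All
  null space and range inclusions below come from this.\<close>

lemma hankel_form_null:
  assumes h: "hermitian_upto h (2 * n)" and pos: "hankel_nonneg h n" and null: "hankel_form h n p = 0" and i: "i \<le> n"
  shows "(\<Sum>k\<le>n. h (i + k) * p k) = 0"
proof (rule rcf_eqI)
  let ?g = "\<Sum>k\<le>n. h (i + k) * p k"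
  fix a b
  let ?w = "matrix_unit a 0" and ?y = "matrix_unit b 0"
  define d where "d = entry (star ?w * h (i + i) * ?w) 0 0"
  have nonneg: "0 \<le> cnj c * cnj (entry ?g a b) + c * entry ?g a b + d" for c
  proof -
    let ?p = "\<lambda>k. p k * (?y * scalar c)"
    have g: "(\<Sum>k\<le>n. h (i + k) * ?p k) = ?g * ?y * scalar c"
      by (simp add: sum_distrib_right mult.assoc)
    have "hankel_form h n (\<lambda>k. ?p k + (if k = i then ?w else 0)) =
        hankel_form h n ?p + star (?g * ?y * scalar c) * ?w + star ?w * (?g * ?y * scalar c)
          + star ?w * h (i + i) * ?w"
      using hankel_form_perturb[OF h i, of ?p ?w] unfolding g .
    also have "hankel_form h n ?p = 0" by (simp only: hankel_form_times null) simp
    also have "star (?g * ?y * scalar c) * ?w = scalar (cnj c) * star (star ?w * ?g * ?y)"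
      by (simp only: star_times star_scalar star_star mult.assoc)
    also have "star ?w * (?g * ?y * scalar c) = scalar c * (star ?w * ?g * ?y)"
      by (simp only: mult.assoc[symmetric] scalar_commute)
    finally have "entry (hankel_form h n (\<lambda>k. ?p k + (if k = i then ?w else 0))) 0 0 =
        cnj c * cnj (entry ?g a b) + c * entry ?g a b + d"
      by (simp add: d_def star.rep_eq entry_matrix_unit_conj del: star_times)
    thus ?thesis using pos unfolding hankel_nonneg_def by metis
  qed
  from nonneg[of 0] have "0 \<le> d" by simp
  with nonneg have "entry ?g a b = 0" by (rule complex_affine_nonneg)
  thus "entry ?g a b = entry 0 a b" by simp
qed

lemma emb_block_hankel:
  assumes q: "0 < q" and s: "\<And>j. j \<le> 2 * n \<Longrightarrow> s j \<in> carrier_mat q q"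
  shows "emb (block_hankel q s n) =
    (\<Sum>j\<le>n. \<Sum>k\<le>n. blk q j * emb (s (j + k)) * star (blk q k))"
proof (rule rcf_eqI)
  fix a b
  have less: "a < q + n * q \<longleftrightarrow> a div q \<le> n" for a
    using div_less_iff_less_mult[OF q, of a "Suc n"] by auto
  have "entry (\<Sum>j\<le>n. \<Sum>k\<le>n. blk q j * emb (s (j + k)) * star (blk q k)) a b =
    (\<Sum>j\<le>n. \<Sum>k\<le>n. if b div q = k then if a div q = j then entry (emb (s (j + k))) (a mod q) (b mod q) else 0 else 0)"
    unfolding entry_sum
    by (intro sum.cong refl) (simp add: entry_times_star_blk[OF q] entry_blk_times[OF q])
  also have "\<dots> = (if a div q \<le> n \<and> b div q \<le> n then entry (emb (s (a div q + b div q))) (a mod q) (b mod q) else 0)"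
    by (cases "b div q \<le> n") simp_all
  also have "\<dots> = entry (emb (block_hankel q s n)) a b"
    using s[of "a div q + b div q"] q by (auto simp: entry_emb block_hankel_def less)
  finally show "entry (emb (block_hankel q s n)) a b =
    entry (\<Sum>j\<le>n. \<Sum>k\<le>n. blk q j * emb (s (j + k)) * star (blk q k)) a b" by simp
qed

lemma emb_block_col:
  assumes q: "0 < q" and s: "\<And>j. j < n \<Longrightarrow> s (m + j) \<in> carrier_mat q q"
  shows "emb (block_col q s m n) = (\<Sum>j<n. blk q j * emb (s (m + j)))"
proof (rule rcf_eqI)
  fix a b
  have less: "a < n * q \<longleftrightarrow> a div q < n" for a
    using div_less_iff_less_mult[OF q, of a n] by auto
  have "entry (\<Sum>j<n. blk q j * emb (s (m + j))) a b =
    (\<Sum>j<n. if a div q = j then entry (emb (s (m + j))) (a mod q) b else 0)"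
    unfolding entry_sum by (intro sum.cong refl) (simp add: entry_blk_times[OF q])
  also have "\<dots> = (if a div q < n then entry (emb (s (m + a div q))) (a mod q) b else 0)"
    by simp
  also have "\<dots> = entry (emb (block_col q s m n)) a b"
    using s[of "a div q"] q by (auto simp: entry_emb block_col_def less)
  finally show "entry (emb (block_col q s m n)) a b = entry (\<Sum>j<n. blk q j * emb (s (m + j))) a b"
    by simp
qed

lemma emb_block_row:
  assumes q: "0 < q" and s: "\<And>j. j < n \<Longrightarrow> s (m + j) \<in> carrier_mat q q"
  shows "emb (block_row q s m n) = (\<Sum>j<n. emb (s (m + j)) * star (blk q j))"
proof (rule rcf_eqI)
  fix a b
  have less: "a < n * q \<longleftrightarrow> a div q < n" for a
    using div_less_iff_less_mult[OF q, of a n] by auto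
  have "entry (\<Sum>j<n. emb (s (m + j)) * star (blk q j)) a b =
    (\<Sum>j<n. if b div q = j then entry (emb (s (m + j))) a (b mod q) else 0)"
    unfolding entry_sum by (intro sum.cong refl) (simp add: entry_times_star_blk[OF q])
  also have "\<dots> = (if b div q < n then entry (emb (s (m + b div q))) a (b mod q) else 0)"
    by simp
  also have "\<dots> = entry (emb (block_row q s m n)) a b"
    using s[of "b div q"] q by (auto simp: entry_emb block_row_def less)
  finally show "entry (emb (block_row q s m n)) a b = entry (\<Sum>j<n. emb (s (m + j)) * star (blk q j)) a b"
    by simp
qed

lemma block_hankel_carrier: "block_hankel q s n \<in> carrier_mat (Suc n * q) (Suc n * q)"
  by (simp add: block_hankel_def)

lemma star_blk_hankel_times:
  assumes q: "0 < q" and s: "\<And>j. j \<le> 2 * n \<Longrightarrow> s j \<in> carrier_mat q q" and i: "i \<le> n"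
  shows "star (blk q i) * (emb (block_hankel q s n) * x) =
    (\<Sum>k\<le>n. emb (s (i + k)) * (star (blk q k) * x))"
proof -
  have "star (blk q i) * (emb (block_hankel q s n) * x) =
      (\<Sum>j\<le>n. if i = j then \<Sum>k\<le>n. idn q * emb (s (j + k)) * (star (blk q k) * x) else 0)"
  proof -
    have "star (blk q i) * (emb (block_hankel q s n) * x) =
        (\<Sum>j\<le>n. \<Sum>k\<le>n. star (blk q i) * (blk q j * (emb (s (j + k)) * (star (blk q k) * x))))"
      unfolding emb_block_hankel[of q n s, OF q s, simplified]
      by (simp add: sum_distrib_left sum_distrib_right mult.assoc)
    thus ?thesis
      by (simp only:) (intro sum.cong refl, simp add: star_blk_blk_times[OF q] mult.assoc)
  qed
  also have "\<dots> = (\<Sum>k\<le>n. idn q * emb (s (i + k)) * (star (blk q k) * x))"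
    using i by simp
  also have "\<dots> = (\<Sum>k\<le>n. emb (s (i + k)) * (star (blk q k) * x))"
    by (intro sum.cong refl) (use i in \<open>simp add: idn_emb[OF s]\<close>)
  finally show ?thesis .
qed

lemma form_block_hankel:
  assumes q: "0 < q" and s: "\<And>j. j \<le> 2 * n \<Longrightarrow> s j \<in> carrier_mat q q"
  shows "star x * emb (block_hankel q s n) * x = hankel_form (\<lambda>j. emb (s j)) n (\<lambda>k. star (blk q k) * x)"
  unfolding emb_block_hankel[of q n s, OF q s, simplified] hankel_form_def
  by (simp add: sum_distrib_left sum_distrib_right mult.assoc)

lemma star_emb_block_hankel:
  assumes q: "0 < q" and s: "\<And>j. j \<le> 2 * n \<Longrightarrow> s j \<in> carrier_mat q q"
    and h: "hermitian_upto (\<lambda>j. emb (s j)) (2 * n)"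
  shows "star (emb (block_hankel q s n)) = emb (block_hankel q s n)"
proof -
  let ?M = "emb (block_hankel q s n)"
  have "star ?M = (\<Sum>j\<le>n. \<Sum>k\<le>n. blk q k * (emb (s (j + k)) * star (blk q j)))"
    unfolding emb_block_hankel[of q n s, OF q s, simplified] star_sum
    by (intro sum.cong refl) (use h in \<open>simp add: hermitian_upto_def\<close>)
  also have "\<dots> = ?M"
    unfolding emb_block_hankel[of q n s, OF q s, simplified]
    by (subst sum.swap) (simp add: add.commute mult.assoc)
  finally show ?thesis .
qed

text \<open>The blocks of a vector \<open>x\<close> are \<open>J\<^sub>k\<^sup>* x\<close>, and conversely blocks \<open>p\<^sub>k\<close> are assembled to
  \<open>\<Sum>\<^sub>k J\<^sub>k p\<^sub>k\<close>; rows of \<open>p\<^sub>k\<close> with index at least \<open>q\<close> are not seen by the form.\<close>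

lemma nonneg_block_hankel_iff:
  assumes q: "0 < q" and s: "\<And>j. j \<le> 2 * n \<Longrightarrow> s j \<in> carrier_mat q q"
  shows "nonneg_hermitian (block_hankel q s n) \<longleftrightarrow>
    hermitian_upto (\<lambda>j. emb (s j)) (2 * n) \<and> hankel_nonneg (\<lambda>j. emb (s j)) n"
proof -
  let ?M = "emb (block_hankel q s n)"
  have "star ?M = ?M \<longleftrightarrow> hermitian_upto (\<lambda>j. emb (s j)) (2 * n)"
  proof
    assume M: "star ?M = ?M"
    show "hermitian_upto (\<lambda>j. emb (s j)) (2 * n)" unfolding hermitian_upto_def
    proof (intro allI impI)
      fix j assume j: "j \<le> 2 * n"
      define i l where "i = min j n" and "l = j - i"
      have il: "i \<le> n" "l \<le> n" "j = i + l" using j by (auto simp: i_def l_def)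
      have ex: "star (blk q i) * (?M * blk q l) = emb (s (i + l))" if "i \<le> n" "l \<le> n" for i l
      proof -
        have "star (blk q i) * (?M * blk q l) = (\<Sum>k\<le>n. if k = l then emb (s (i + k)) * idn q else 0)"
          unfolding star_blk_hankel_times[of q n s, OF q s that(1), simplified]
          by (intro sum.cong) (auto simp: star_blk_blk[OF q])
        thus ?thesis using that by (simp add: emb_idn[OF s])
      qed
      have "star (emb (s j)) = star (star (blk q i) * (?M * blk q l))" using ex il by simp
      also have "\<dots> = star (blk q l) * (?M * blk q i)" by (simp add: M mult.assoc)
      also have "\<dots> = emb (s j)" using ex il by (simp add: add.commute)
      finally show "star (emb (s j)) = emb (s j)" .
    qed
  next
    assume h: "hermitian_upto (\<lambda>j. emb (s j)) (2 * n)"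
    show "star ?M = ?M" by (rule star_emb_block_hankel[OF q s h])
  qed
  moreover have "(\<forall>x. 0 \<le> entry (star x * ?M * x) 0 0) \<longleftrightarrow> hankel_nonneg (\<lambda>j. emb (s j)) n"
    unfolding form_block_hankel[of q n s, OF q s, simplified] hankel_nonneg_def
  proof safe
    fix p assume *: "\<forall>x. 0 \<le> entry (hankel_form (\<lambda>j. emb (s j)) n (\<lambda>k. star (blk q k) * x)) 0 0"
    have "hankel_form (\<lambda>j. emb (s j)) n p =
        hankel_form (\<lambda>j. emb (s j)) n (\<lambda>k. star (blk q k) * (\<Sum>l\<le>n. blk q l * p l))"
    proof -
      have e: "star (blk q k) * (\<Sum>l\<le>n. blk q l * p l) = idn q * p k" if "k \<le> n" for k
        using that by (simp add: sum_distrib_left star_blk_blk_times[OF q])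
      have "star (p j) * emb (s (j + k)) * p k =
          star (idn q * p j) * emb (s (j + k)) * (idn q * p k)" if "j \<le> n" "k \<le> n" for j k
      proof -
        have c: "s (j + k) \<in> carrier_mat q q" using that by (intro s) simp
        have "star (idn q * p j) * emb (s (j + k)) * (idn q * p k) =
            star (p j) * (idn q * emb (s (j + k)) * idn q) * p k" by (simp add: mult.assoc)
        thus ?thesis by (simp only: idn_emb[OF c] emb_idn[OF c])
      qed
      thus ?thesis unfolding hankel_form_def by (intro sum.cong refl) (simp only: e atMost_iff)
    qed
    thus "0 \<le> entry (hankel_form (\<lambda>j. emb (s j)) n p) 0 0" using * by simp
  qed auto
  moreover have "square_mat (block_hankel q s n)"
    by (simp add: block_hankel_def)
  ultimately show ?thesis by (simp add: nonneg_hermitian_iff)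
qed

lemma nonneg_block_hankel_mono:
  assumes "0 < q" "\<And>j. j \<le> 2 * n \<Longrightarrow> s j \<in> carrier_mat q q"
    and "nonneg_hermitian (block_hankel q s n)" "m \<le> n"
  shows "nonneg_hermitian (block_hankel q s m)"
proof -
  have "hermitian_upto (\<lambda>j. emb (s j)) (2 * n)" "hankel_nonneg (\<lambda>j. emb (s j)) n"
    using assms(3) nonneg_block_hankel_iff[of q n s] assms(1,2) by auto
  hence "hermitian_upto (\<lambda>j. emb (s j)) (2 * m)" "hankel_nonneg (\<lambda>j. emb (s j)) m"
    using assms(4) hankel_nonneg_mono by (auto simp: hermitian_upto_def)
  thus ?thesis using nonneg_block_hankel_iff[of q m s] assms(1,2,4) by auto
qed

section \<open>Schur complements from solutions of block Hankel systems\<close>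

text \<open>With \<open>M\<close> the Hankel matrix of size \<open>n\<close>, \<open>X\<close> its Moore--Penrose inverse and \<open>b\<close> its next block
  column, the claim is that \<open>b\<close> lies in the range of \<open>M\<close>. The defect \<open>c = b - M X b\<close> satisfies
  \<open>M c = 0\<close>, so the form of the larger Hankel matrix vanishes at \<open>(c, 0)\<close>, and its last row gives
  \<open>b\<^sup>* c = 0\<close>. As \<open>c\<close> is an orthogonal projection of \<open>b\<close>, this means \<open>c\<^sup>* c = 0\<close>.\<close>

lemma schur_solution_exists:
  assumes q: "0 < q" and s: "\<And>j. j \<le> 2 * n \<Longrightarrow> s j \<in> carrier_mat q q"
    and h: "hermitian_upto (\<lambda>j. emb (s j)) (2 * n)" and pos: "hankel_nonneg (\<lambda>j. emb (s j)) n"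
  shows "\<exists>W. W n = 1 \<and> (\<forall>j<n. (\<Sum>k\<le>n. emb (s (j + k)) * W k) = 0)"
proof (cases n)
  case 0
  thus ?thesis by (intro exI[of _ "\<lambda>_. 1"]) simp
next
  case (Suc m)
  let ?h = "\<lambda>j. emb (s j)"
  have sm: "\<And>j. j \<le> 2 * m \<Longrightarrow> s j \<in> carrier_mat q q" using s Suc by simp
  let ?A = "block_hankel q s m"
  define M where "M = emb ?A"
  have hM: "star M = M"
    unfolding M_def by (rule star_emb_block_hankel[OF q sm]) (use h Suc in \<open>auto simp: hermitian_upto_def\<close>)
  define X where "X = emb (moore_penrose ?A)"
  have X: "M * X * M = M" "X * M * X = X" "star (M * X) = M * X"
    using moore_penrose_hermitian(2)[OF block_hankel_carrier, of q s m] hM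
    by (auto simp: mp_inverse_def M_def X_def)
  define b where "b = (\<Sum>k\<le>m. blk q k * ?h (n + k))"
  have blk_b: "star (blk q j) * b = ?h (n + j)" if "j \<le> m" for j
  proof -
    have "star (blk q j) * b = idn q * ?h (n + j)"
      using that by (simp add: b_def sum_distrib_left star_blk_blk_times[OF q])
    thus ?thesis using that Suc by (simp add: idn_emb[OF s])
  qed
  have star_b: "star b = (\<Sum>k\<le>m. ?h (n + k) * star (blk q k))"
    unfolding b_def star_sum using h Suc by (intro sum.cong) (auto simp: hermitian_upto_def)
  define c where "c = b - M * X * b"
  have Mc: "M * c = 0"
  proof -
    have "M * (M * X) = M" 
      using arg_cong[OF X(1), of star] X(3) by (metis hM star_times mult.assoc)
    thus ?thesis by (simp add: c_def right_diff_distrib flip: mult.assoc)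
  qed
  \<comment> \<open>The blocks of the vector \<open>(c, 0)\<close>.\<close>
  define p where "p k = (if k \<le> m then star (blk q k) * c else 0)" for k
  have rows: "(\<Sum>k\<le>n. ?h (j + k) * p k) = (\<Sum>k\<le>m. ?h (j + k) * (star (blk q k) * c))" for j
    using Suc by (simp add: p_def)
  have rows0: "(\<Sum>k\<le>n. ?h (j + k) * p k) = 0" if "j \<le> m" for j
    using star_blk_hankel_times[of q m s, OF q sm that, simplified, of c] Mc rows by (simp add: M_def)
  have "hankel_form ?h n p = (\<Sum>j\<le>n. star (p j) * (\<Sum>k\<le>n. ?h (j + k) * p k))"
    by (simp add: hankel_form_def sum_distrib_left mult.assoc)
  also have "\<dots> = 0"
  proof (intro sum.neutral ballI)
    fix j assume "j \<in> {..n}"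
    show "star (p j) * (\<Sum>k\<le>n. ?h (j + k) * p k) = 0"
      by (cases "j \<le> m") (simp_all add: rows0, simp add: p_def)
  qed
  finally have "(\<Sum>k\<le>n. ?h (n + k) * p k) = 0"
    by (intro hankel_form_null[OF h pos]) auto
  hence "star b * c = 0"
    unfolding rows star_b by (simp add: sum_distrib_right mult.assoc)
  moreover have "star c = star b - star b * (M * X)"
    by (simp only: c_def star_minus star_times[of "M * X"] X(3))
  hence "star c * c = star b * c - star b * (M * (X * c))"
    by (simp add: left_diff_distrib mult.assoc)
  moreover have "X * c = 0"
    using X(2) by (simp add: c_def right_diff_distrib flip: mult.assoc)
  ultimately have "star c * c = 0" by simp
  hence "c = 0" by (rule star_self_eq_0)
  hence b: "M * (X * b) = b" by (simp add: c_def mult.assoc)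
  let ?W = "\<lambda>k. if k = n then 1 else - (star (blk q k) * (X * b))"
  have "(\<Sum>k\<le>n. ?h (j + k) * ?W k) = 0" if "j < n" for j
  proof -
    have j: "j \<le> m" using that Suc by simp
    have "(\<Sum>k\<le>n. ?h (j + k) * ?W k) = (\<Sum>k\<le>m. ?h (j + k) * ?W k) + ?h (j + n)"
      by (simp add: Suc)
    also have "(\<Sum>k\<le>m. ?h (j + k) * ?W k) = - (\<Sum>k\<le>m. ?h (j + k) * (star (blk q k) * (X * b)))"
      unfolding sum_negf[symmetric] by (intro sum.cong) (auto simp: Suc)
    also have "(\<Sum>k\<le>m. ?h (j + k) * (star (blk q k) * (X * b))) = star (blk q j) * b"
      using star_blk_hankel_times[of q m s, OF q sm j, simplified, of "X * b"] b by (simp add: M_def)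
    finally show ?thesis using blk_b[OF j] by (simp add: add.commute)
  qed
  thus ?thesis by (intro exI[of _ ?W]) simp
qed

text \<open>If \<open>M Z = b\<close>, then \<open>b\<^sup>* X b = Z\<^sup>* M X M Z = Z\<^sup>* M Z = b\<^sup>* Z\<close>, whichever solution \<open>Z\<close> was
  chosen. So any block column \<open>W\<close> with last block \<open>1\<close> that is annihilated by the upper rows
  computes the Schur complement in the last row, and Schur complements of congruent matrices can be
  compared without relating their Moore--Penrose inverses.\<close>

lemma schur_compl_by_solution:
  assumes q: "0 < q" and s: "\<And>j. j \<le> 2 * n \<Longrightarrow> s j \<in> carrier_mat q q"
    and h: "hermitian_upto (\<lambda>j. emb (s j)) (2 * n)"
    and W: "W n = 1" "\<And>j. j < n \<Longrightarrow> (\<Sum>k\<le>n. emb (s (j + k)) * W k) = 0"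
  shows "emb (hankel_schur_compl q s n) = (\<Sum>k\<le>n. emb (s (n + k)) * W k)"
proof (cases n)
  case 0
  thus ?thesis using W by (simp add: hankel_schur_compl_def)
next
  case (Suc m)
  let ?h = "\<lambda>j. emb (s j)"
  have sm: "\<And>j. j \<le> 2 * m \<Longrightarrow> s j \<in> carrier_mat q q" using s Suc by simp
  let ?A = "block_hankel q s m"
  define M where "M = emb ?A"
  have hM: "star M = M"
    unfolding M_def by (rule star_emb_block_hankel[OF q sm]) (use h Suc in \<open>auto simp: hermitian_upto_def\<close>)
  define X where "X = emb (moore_penrose ?A)"
  have Xc: "moore_penrose ?A \<in> carrier_mat (n * q) (n * q)" and X: "M * X * M = M"
    using moore_penrose_hermitian[OF block_hankel_carrier, of q s m] hM Suc
    by (auto simp: mp_inverse_def M_def X_def)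
  have sn: "s (n + j) \<in> carrier_mat q q" if "j < n" for j using that by (intro s) simp
  define b where "b = emb (block_col q s n n)"
  have b: "b = (\<Sum>k\<le>m. blk q k * ?h (n + k))"
    using emb_block_col[of q n s n, OF q sn] Suc by (simp add: b_def lessThan_Suc_atMost)
  have star_b: "star b = (\<Sum>k\<le>m. ?h (n + k) * star (blk q k))"
    unfolding b star_sum using h Suc by (intro sum.cong) (auto simp: hermitian_upto_def)
  have row: "emb (block_row q s n n) = star b"
    using emb_block_row[of q n s n, OF q sn] Suc by (simp add: star_b lessThan_Suc_atMost)
  define Z where "Z = - (\<Sum>k\<le>m. blk q k * W k)"
  have blk_Z: "?h l * (star (blk q k) * Z) = - (?h l * W k)" if "k \<le> m" "l \<le> 2 * n" for k l
  proof -
    have "star (blk q k) * Z = - (idn q * W k)"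
      using that(1) by (simp add: Z_def sum_distrib_left star_blk_blk_times[OF q])
    thus ?thesis using emb_idn[OF s[OF that(2)]] by (simp flip: mult.assoc)
  qed
  have MZ: "M * Z = b"
  proof -
    have "M * Z = (\<Sum>j\<le>m. blk q j * (\<Sum>k\<le>m. ?h (j + k) * (star (blk q k) * Z)))"
      unfolding M_def emb_block_hankel[of q m s, OF q sm, simplified]
      by (simp add: sum_distrib_left sum_distrib_right mult.assoc)
    also have "\<dots> = b" unfolding b
    proof (intro sum.cong refl)
      fix j assume j: "j \<in> {..m}"
      have "(\<Sum>k\<le>m. ?h (j + k) * (star (blk q k) * Z)) = - (\<Sum>k\<le>m. ?h (j + k) * W k)"
        unfolding sum_negf[symmetric] using j Suc by (intro sum.cong) (auto simp: blk_Z)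
      also have "\<dots> = ?h (n + j)"
        using W(2)[of j] W(1) j Suc by (simp add: add.commute minus_unique neg_eq_iff_add_eq_0)
      finally show "blk q j * (\<Sum>k\<le>m. ?h (j + k) * (star (blk q k) * Z)) = blk q j * ?h (n + j)"
        by simp
    qed
    finally show ?thesis .
  qed
  have dims: "block_row q s n n \<in> carrier_mat q (n * q)" "block_col q s n n \<in> carrier_mat (n * q) q"
    by (auto simp: block_row_def block_col_def)
  have "emb (hankel_schur_compl q s n) = ?h (2 * n) - star b * X * b"
  proof -
    have "emb (s (2 * n) - block_row q s n n * moore_penrose ?A * block_col q s n n) =
        ?h (2 * n) - emb (block_row q s n n * moore_penrose ?A * block_col q s n n)"
      by (rule emb_minus[of _ q q]) (use s[of "2 * n"] dims Xc in auto)
    also have "emb (block_row q s n n * moore_penrose ?A * block_col q s n n) = star b * X * b"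
      using dims Xc by (simp add: emb_mult row X_def b_def mult.assoc)
    finally show ?thesis using Suc by (simp add: hankel_schur_compl_def)
  qed
  also have "star b * X * b = star Z * (M * X * M) * Z"
    by (simp add: hM mult.assoc flip: MZ)
  also have "\<dots> = star b * Z" unfolding X by (simp add: hM flip: MZ)
  also have "\<dots> = - (\<Sum>k\<le>m. ?h (n + k) * W k)"
    unfolding star_b sum_distrib_right sum_negf[symmetric] mult.assoc
    by (intro sum.cong refl blk_Z) (use Suc in auto)
  finally show ?thesis using W(1) by (simp add: Suc add.commute mult_2)
qed

section \<open>Hankel matrices of reciprocal power series\<close>

text \<open>A Hankel matrix times an upper triangular Toeplitz matrix yields the coefficients of the
  product series, up to the terms whose index lies before the row.\<close>

lemma hankel_conv:
  fixes f g :: "nat \<Rightarrow> 'a :: ring_1"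
  shows "(\<Sum>b\<le>k. f (a + b) * (d * g (k - b))) =
    fps_nth (Abs_fps f * fps_const d * Abs_fps g) (a + k) - (\<Sum>i<a. f i * (d * g (a + k - i)))"
proof -
  have "fps_nth (Abs_fps f * fps_const d * Abs_fps g) (a + k) = (\<Sum>i\<in>{0..a + k}. f i * (d * g (a + k - i)))"
    unfolding fps_mult_nth[of "Abs_fps f * fps_const d"] by (simp add: mult.assoc)
  also have "\<dots> = (\<Sum>i\<in>{..<a} \<union> {a..a + k}. f i * (d * g (a + k - i)))"
    by (rule sum.cong) auto
  also have "\<dots> = (\<Sum>i<a. f i * (d * g (a + k - i))) + (\<Sum>i\<in>{a..a + k}. f i * (d * g (a + k - i)))"
    by (rule sum.union_disjoint) auto
  also have "(\<Sum>i\<in>{a..a + k}. f i * (d * g (a + k - i))) = (\<Sum>b\<le>k. f (a + b) * (d * g (k - b)))"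
    by (rule sum.reindex_bij_witness[of _ "\<lambda>b. a + b" "\<lambda>i. i - a"]) (auto simp: add.commute)
  finally show ?thesis by simp
qed

text \<open>The summand \<open>e\<close> in the last block allows for a correction on which the Hankel matrix vanishes.\<close>

lemma toeplitz_apply:
  fixes h c V :: "nat \<Rightarrow> 'a :: ring_1"
  shows "(\<Sum>b\<le>N. h (a + b) * ((\<Sum>k\<le>N. if b \<le> k then c (k - b) * V k else 0) + (if b = N then e else 0))) =
    (\<Sum>k\<le>N. (\<Sum>b\<le>k. h (a + b) * c (k - b)) * V k) + h (a + N) * e"
proof -
  have "(\<Sum>b\<le>N. h (a + b) * ((\<Sum>k\<le>N. if b \<le> k then c (k - b) * V k else 0) + (if b = N then e else 0))) =
      (\<Sum>b\<le>N. \<Sum>k\<le>N. if b \<le> k then h (a + b) * c (k - b) * V k else 0)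
      + (\<Sum>b\<le>N. if b = N then h (a + N) * e else 0)"
    unfolding sum.distrib[symmetric]
    by (intro sum.cong refl) (simp add: distrib_left sum_distrib_left if_distrib mult.assoc cong: if_cong)
  also have "(\<Sum>b\<le>N. if b = N then h (a + N) * e else 0) = h (a + N) * e" by simp
  also have "(\<Sum>b\<le>N. \<Sum>k\<le>N. if b \<le> k then h (a + b) * c (k - b) * V k else 0) =
      (\<Sum>k\<le>N. \<Sum>b\<le>N. if b \<le> k then h (a + b) * c (k - b) * V k else 0)"
    by (rule sum.swap)
  also have "\<dots> = (\<Sum>k\<le>N. (\<Sum>b\<le>k. h (a + b) * c (k - b)) * V k)"
  proof (intro sum.cong refl)
    fix k assume k: "k \<in> {..N}"
    have "(\<Sum>b\<le>N. if b \<le> k then h (a + b) * c (k - b) * V k else 0) =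
        (\<Sum>b\<le>k. if b \<le> k then h (a + b) * c (k - b) * V k else 0)"
      by (rule sum.mono_neutral_right) (use k in auto)
    thus "(\<Sum>b\<le>N. if b \<le> k then h (a + b) * c (k - b) * V k else 0) =
        (\<Sum>b\<le>k. h (a + b) * c (k - b)) * V k"
      by (simp add: sum_distrib_right)
  qed
  finally show ?thesis .
qed

text \<open>The form of a Hankel matrix at a vector \<open>C w\<close>, with \<open>C\<close> the upper triangular Toeplitz matrix of
  \<open>c\<close>, is the form of the congruent matrix \<open>C\<^sup>* H C\<close> at \<open>w\<close>.\<close>

lemma hankel_form_toeplitz:
  defines "y \<equiv> (\<lambda>c w n b. \<Sum>k\<le>n. if b \<le> k then c (k - b) * w k else 0)"
  shows "hankel_form h n (y c w n) =
    (\<Sum>j\<le>n. \<Sum>k\<le>n. star (w j) * (\<Sum>a\<le>j. star (c (j - a)) * (\<Sum>b\<le>k. h (a + b) * c (k - b))) * w k)"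
proof -
  define B where "B a k = (\<Sum>b\<le>k. h (a + b) * c (k - b))" for a k
  define z where "z a = (\<Sum>b\<le>n. h (a + b) * y c w n b)" for a
  have z: "z a = (\<Sum>k\<le>n. B a k * w k)" for a
    unfolding z_def y_def B_def using toeplitz_apply[where e = 0 and h = h and a = a and N = n and c = c and V = w] by simp
  have "hankel_form h n (y c w n) = (\<Sum>a\<le>n. star (y c w n a) * z a)"
    by (simp add: hankel_form_def z_def sum_distrib_left mult.assoc)
  also have "\<dots> = (\<Sum>a\<le>n. \<Sum>j\<le>n. if a \<le> j then star (w j) * (star (c (j - a)) * z a) else 0)"
    unfolding y_def star_sum sum_distrib_right
    by (intro sum.cong refl) (simp add: mult.assoc)
  also have "\<dots> = (\<Sum>j\<le>n. \<Sum>a\<le>n. if a \<le> j then star (w j) * (star (c (j - a)) * z a) else 0)"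
    by (rule sum.swap)
  also have "\<dots> = (\<Sum>j\<le>n. \<Sum>a\<le>j. star (w j) * (star (c (j - a)) * z a))"
  proof (rule sum.cong[OF refl])
    fix j assume j: "j \<in> {..n}"
    have "(\<Sum>a\<le>n. if a \<le> j then star (w j) * (star (c (j - a)) * z a) else 0) =
        (\<Sum>a\<le>j. if a \<le> j then star (w j) * (star (c (j - a)) * z a) else 0)"
      by (rule sum.mono_neutral_right) (use j in auto)
    thus "(\<Sum>a\<le>n. if a \<le> j then star (w j) * (star (c (j - a)) * z a) else 0) =
        (\<Sum>a\<le>j. star (w j) * (star (c (j - a)) * z a))" by simp
  qed
  also have "\<dots> = (\<Sum>j\<le>n. \<Sum>k\<le>n. \<Sum>a\<le>j. star (w j) * (star (c (j - a)) * (B a k * w k)))"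
    unfolding z sum_distrib_left by (rule sum.cong[OF refl]) (rule sum.swap)
  also have "\<dots> = (\<Sum>j\<le>n. \<Sum>k\<le>n. star (w j) * (\<Sum>a\<le>j. star (c (j - a)) * B a k) * w k)"
    by (intro sum.cong refl) (simp only: sum_distrib_left sum_distrib_right mult.assoc)
  finally show ?thesis unfolding B_def .
qed

definition star_fps :: "rcf fps \<Rightarrow> rcf fps" where
  "star_fps F = Abs_fps (\<lambda>n. star (fps_nth F n))"

lemma star_fps_mult: "star_fps (F * G) = star_fps G * star_fps F"
proof (rule fps_ext)
  fix n
  have "fps_nth (star_fps (F * G)) n = (\<Sum>i=0..n. star (fps_nth G (n - i)) * star (fps_nth F i))"
    by (simp add: star_fps_def fps_mult_nth)
  also have "\<dots> = (\<Sum>i=0..n. star (fps_nth G i) * star (fps_nth F (n - i)))"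
    by (rule sum.reindex_bij_witness[of _ "\<lambda>i. n - i" "\<lambda>i. n - i"]) auto
  also have "\<dots> = fps_nth (star_fps G * star_fps F) n"
    by (simp add: star_fps_def fps_mult_nth)
  finally show "fps_nth (star_fps (F * G)) n = fps_nth (star_fps G * star_fps F) n" .
qed

lemma star_fps_const [simp]: "star_fps (fps_const a) = fps_const (star a)"
  by (rule fps_ext) (simp add: star_fps_def)

lemma star_fps_Abs: "star_fps (Abs_fps f) = Abs_fps (\<lambda>n. star (f n))"
  by (rule fps_ext) (simp add: star_fps_def)

text \<open>Two Hermitian series \<open>F\<close>, \<open>G\<close> with common constant term \<open>s\<^sub>0\<close>, reciprocal in the sense
  \<open>F d G = s\<^sub>0\<close>. Here \<open>d\<close> plays the part of \<open>s\<^sub>0\<^sup>\<dagger>\<close> and \<open>P\<close> that of the projection onto the range of \<open>s\<^sub>0\<close>.\<close>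

locale reciprocal_pair =
  fixes f g :: "nat \<Rightarrow> rcf" and d P :: rcf
  assumes f_star: "star (f j) = f j" and g_star: "star (g j) = g j" and d_star: "star d = d"
    and g_0: "g 0 = f 0" and f0_d: "f 0 * d = P" and d_f0: "d * f 0 = P"
    and f_P: "f j * P = f j" and P_g: "P * g j = g j"
    and conv: "Abs_fps f * fps_const d * Abs_fps g = fps_const (f 0)"
begin

lemma conv': "Abs_fps g * fps_const d * Abs_fps f = fps_const (f 0)"
  using arg_cong[OF conv, of star_fps]
  by (simp add: star_fps_mult star_fps_Abs f_star g_star d_star mult.assoc)

text \<open>Row \<open>a\<close>, column \<open>k\<close> of the Hankel matrix of \<open>F\<close> times the Toeplitz matrix of \<open>d G\<close>.\<close>

definition T :: "nat \<Rightarrow> nat \<Rightarrow> rcf" where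
  "T a k = (\<Sum>b\<le>k. f (a + b) * (d * g (k - b)))"

lemma T_eq: "T a k = (if a + k = 0 then f 0 else 0) + (\<Sum>i<a. f i * (d * - g (a + k - i)))"
  unfolding T_def hankel_conv conv by (simp add: sum_negf)

text \<open>A column that is the convolution of \<open>F d\<close> with \<open>K\<close> returns to \<open>K\<close> under convolution with \<open>G d\<close>,
  because \<open>G d F d K = s\<^sub>0 d K = P K\<close>.\<close>

lemma undo_left_factor:
  assumes "\<And>a. M a = (\<Sum>i\<le>a. f i * (d * K (a - i)))" "P * K j = K j"
  shows "(\<Sum>a\<le>j. g (j - a) * d * M a) = K j"
proof -
  let ?G = "Abs_fps g" and ?F = "Abs_fps f" and ?D = "fps_const d" and ?K = "Abs_fps K"
  have M: "Abs_fps M = ?F * ?D * ?K"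
    by (rule fps_ext, subst fps_mult_nth) (simp add: assms(1) mult.assoc atLeast0AtMost)
  have "(\<Sum>a\<le>j. g (j - a) * d * M a) = (\<Sum>i=0..j. g i * d * M (j - i))"
    by (rule sum.reindex_bij_witness[of _ "\<lambda>i. j - i" "\<lambda>i. j - i"]) auto
  also have "\<dots> = fps_nth (?G * ?D * Abs_fps M) j"
    by (simp add: fps_mult_nth[of "?G * ?D"])
  also have "?G * ?D * Abs_fps M = (?G * ?D * ?F) * ?D * ?K"
    by (simp only: M mult.assoc)
  also have "fps_nth \<dots> j = P * K j"
    by (simp only: conv') (simp add: f0_d)
  finally show ?thesis using assms(2) by simp
qed

text \<open>The two congruences, for the Hankel matrices starting at \<open>f\<^sub>1\<close> and at \<open>f\<^sub>0\<close>. In both,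
  \<open>T_eq\<close> exhibits the columns of \<open>T\<close> as convolutions with \<open>F d\<close>. In the second, the entry in row
  \<open>0\<close> vanishes for every column of index at least \<open>1\<close>, so the first block splits off.\<close>

lemma congruence_shift: "(\<Sum>a\<le>j. g (j - a) * d * T (Suc a) k) = - g (Suc (j + k))"
proof -
  have "T (Suc a) k = (\<Sum>i\<le>a. f i * (d * - g (Suc (a - i + k))))" for a
    unfolding T_eq lessThan_Suc_atMost by (auto intro!: sum.cong simp: Suc_diff_le)
  from undo_left_factor[OF this] show ?thesis by (simp add: P_g)
qed

lemma congruence_double_shift: "(\<Sum>a\<le>j. g (j - a) * d * T a (Suc k)) = (if j = 0 then 0 else - g (j + Suc k))"
proof -
  have "T a (Suc k) = (\<Sum>i\<le>a. f i * (d * (if a - i = 0 then 0 else - g (a - i + Suc k))))" for a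
  proof -
    have "T a (Suc k) = (\<Sum>i<a. f i * (d * (if a - i = 0 then 0 else - g (a - i + Suc k))))"
      unfolding T_eq by (auto intro!: sum.cong simp: Suc_diff_le)
    thus ?thesis by (simp flip: lessThan_Suc_atMost)
  qed
  from undo_left_factor[OF this] show ?thesis by (simp add: P_g)
qed

lemma hankel_nonneg_shift:
  assumes "hankel_nonneg (\<lambda>j. f (Suc j)) n"
  shows "hankel_nonneg (\<lambda>j. - g (Suc j)) n"
  unfolding hankel_nonneg_def
proof
  fix w :: "nat \<Rightarrow> rcf"
  have "hankel_form (\<lambda>j. - g (Suc j)) n w =
      (\<Sum>j\<le>n. \<Sum>k\<le>n. star (w j) * (\<Sum>a\<le>j. g (j - a) * d * T (Suc a) k) * w k)"
    by (simp only: congruence_shift hankel_form_def)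
  also have "\<dots> = hankel_form (\<lambda>j. f (Suc j)) n (\<lambda>b. \<Sum>k\<le>n. if b \<le> k then d * g (k - b) * w k else 0)"
    unfolding hankel_form_toeplitz[of "\<lambda>j. f (Suc j)" n "\<lambda>j. d * g j" w] T_def
    by (simp add: g_star d_star)
  finally show "0 \<le> entry (hankel_form (\<lambda>j. - g (Suc j)) n w) 0 0"
    using assms by (simp only: hankel_nonneg_def)
qed

lemma hankel_nonneg_double_shift:
  assumes "hankel_nonneg f (Suc n)"
  shows "hankel_nonneg (\<lambda>j. - g (Suc (Suc j))) n"
  unfolding hankel_nonneg_def
proof
  fix w :: "nat \<Rightarrow> rcf"
  \<comment> \<open>The split-off first block receives the zero vector.\<close>
  define w' where "w' k = (case k of 0 \<Rightarrow> 0 | Suc l \<Rightarrow> w l)" for k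
  let ?y = "\<lambda>b. \<Sum>k\<le>Suc n. if b \<le> k then d * g (k - b) * w' k else 0"
  have "hankel_form f (Suc n) ?y =
      (\<Sum>j\<le>Suc n. \<Sum>k\<le>Suc n. star (w' j) * (\<Sum>a\<le>j. g (j - a) * d * T a k) * w' k)"
    unfolding hankel_form_toeplitz[of f "Suc n" "\<lambda>j. d * g j" w'] T_def
    by (simp add: g_star d_star)
  also have "\<dots> = (\<Sum>j\<le>n. \<Sum>k\<le>n. star (w j) * (\<Sum>a\<le>Suc j. g (Suc j - a) * d * T a (Suc k)) * w k)"
    unfolding sum.atMost_Suc_shift[of _ n] w'_def by simp
  also have "\<dots> = hankel_form (\<lambda>j. - g (Suc (Suc j))) n w"
    by (simp only: congruence_double_shift hankel_form_def) simp
  finally have "hankel_form f (Suc n) ?y = hankel_form (\<lambda>j. - g (Suc (Suc j))) n w" .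
  moreover have "0 \<le> entry (hankel_form f (Suc n) ?y) 0 0"
    using assms unfolding hankel_nonneg_def by (rule spec)
  ultimately show "0 \<le> entry (hankel_form (\<lambda>j. - g (Suc (Suc j))) n w) 0 0" by (simp only:)
qed

text \<open>The Toeplitz matrix of \<open>d G\<close> has \<open>P\<close> instead of \<open>1\<close> on its diagonal. Adding \<open>1 - P\<close>, which every \<open>f\<^sub>j\<close>
  annihilates, to the last block keeps that block equal to \<open>1\<close>.\<close>

lemma T_solution:
  assumes V: "V N = 1"
  shows "\<exists>W. W N = 1 \<and> (\<forall>a. (\<Sum>b\<le>N. f (a + b) * W b) = (\<Sum>k\<le>N. T a k * V k))"
proof -
  define W where "W b = (\<Sum>k\<le>N. if b \<le> k then d * g (k - b) * V k else 0)
      + (if b = N then 1 - P else 0)" for b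
  have "(\<Sum>k\<le>N. if N \<le> k then d * g (k - N) * V k else 0) = (\<Sum>k\<le>N. if k = N then P else 0)"
    by (intro sum.cong refl) (use V in \<open>auto simp: g_0 d_f0\<close>)
  hence "W N = 1" by (simp add: W_def)
  have "f m * (1 - P) = 0" for m by (simp add: right_diff_distrib f_P)
  hence "(\<Sum>b\<le>N. f (a + b) * W b) = (\<Sum>k\<le>N. T a k * V k)" for a
    unfolding W_def by (subst toeplitz_apply) (simp add: T_def)
  with \<open>W N = 1\<close> show ?thesis by blast
qed

text \<open>Solutions of the Hankel systems of \<open>- G\<close> are carried to solutions of those of \<open>F\<close> with
  the same last row \<open>E\<close>. The lower triangular factor \<open>F d\<close> acts on a right-hand side that is
  concentrated in its last block, where it is multiplication by \<open>P\<close>.\<close>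

lemma schur_solution_shift:
  assumes V: "V n = 1" and E: "\<And>j. j \<le> n \<Longrightarrow> (\<Sum>k\<le>n. - g (Suc (j + k)) * V k) = (if j = n then E else 0)"
  shows "\<exists>W. W n = 1 \<and> (\<forall>j\<le>n. (\<Sum>k\<le>n. f (Suc (j + k)) * W k) = (if j = n then E else 0))"
proof -
  obtain W where W: "W n = 1" "\<And>a. (\<Sum>b\<le>n. f (a + b) * W b) = (\<Sum>k\<le>n. T a k * V k)"
    using T_solution[of V n, OF V] by blast
  have PE: "P * E = E" unfolding E[of n, simplified, symmetric]
    by (simp add: sum_distrib_left P_g flip: mult.assoc)
  have "(\<Sum>k\<le>n. f (Suc (j + k)) * W k) = (if j = n then E else 0)" if j: "j \<le> n" for j
  proof -
    have "(\<Sum>k\<le>n. f (Suc (j + k)) * W k) = (\<Sum>k\<le>n. T (Suc j) k * V k)"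
      using W(2)[of "Suc j"] by simp
    also have "\<dots> = (\<Sum>k\<le>n. \<Sum>i\<le>j. f i * (d * (- g (Suc (j - i + k)) * V k)))"
      unfolding T_eq lessThan_Suc_atMost
      by (intro sum.cong refl) (auto simp: sum_distrib_right mult.assoc Suc_diff_le intro!: sum.cong)
    also have "\<dots> = (\<Sum>i\<le>j. \<Sum>k\<le>n. f i * (d * (- g (Suc (j - i + k)) * V k)))"
      by (rule sum.swap)
    also have "\<dots> = (\<Sum>i\<le>j. f i * (d * (\<Sum>k\<le>n. - g (Suc (j - i + k)) * V k)))"
      by (simp only: sum_distrib_left)
    also have "\<dots> = (\<Sum>i\<le>j. if i = 0 then if j = n then f 0 * (d * E) else 0 else 0)"
    proof (intro sum.cong refl)
      fix i assume i: "i \<in> {..j}"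
      have "j - i \<le> n" using j by simp
      from E[OF this] show "f i * (d * (\<Sum>k\<le>n. - g (Suc (j - i + k)) * V k)) =
          (if i = 0 then if j = n then f 0 * (d * E) else 0 else 0)"
        using i j by (simp only:) auto
    qed
    also have "\<dots> = (if j = n then E else 0)"
      using PE by (simp add: f0_d flip: mult.assoc)
    finally show ?thesis .
  qed
  thus ?thesis using W(1) by blast
qed

lemma schur_solution_double_shift:
  assumes V: "V n = 1" and E: "\<And>j. j \<le> n \<Longrightarrow> (\<Sum>k\<le>n. - g (Suc (Suc (j + k))) * V k) = (if j = n then E else 0)"
  shows "\<exists>W. W (Suc n) = 1 \<and> (\<forall>j\<le>Suc n. (\<Sum>k\<le>Suc n. f (j + k) * W k) = (if j = Suc n then E else 0))"
proof -
  \<comment> \<open>The first block of the larger system receives zero.\<close>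
  define V' where "V' k = (case k of 0 \<Rightarrow> 0 | Suc l \<Rightarrow> V l)" for k
  have V': "V' (Suc n) = 1" using V by (simp add: V'_def)
  obtain W where W: "W (Suc n) = 1" "\<And>a. (\<Sum>b\<le>Suc n. f (a + b) * W b) = (\<Sum>k\<le>Suc n. T a k * V' k)"
    using T_solution[of V' "Suc n", OF V'] by blast
  have PE: "P * E = E" unfolding E[of n, simplified, symmetric]
    by (simp add: sum_distrib_left P_g flip: mult.assoc)
  have "(\<Sum>k\<le>Suc n. f (j + k) * W k) = (if j = Suc n then E else 0)" if j: "j \<le> Suc n" for j
  proof -
    have "(\<Sum>k\<le>Suc n. f (j + k) * W k) = (\<Sum>k\<le>n. T j (Suc k) * V k)"
      unfolding W(2) sum.atMost_Suc_shift[of _ n] V'_def by simp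
    also have "\<dots> = (\<Sum>k\<le>n. \<Sum>i<j. f i * (d * (- g (Suc (Suc (j - Suc i + k))) * V k)))"
      unfolding T_eq by (intro sum.cong refl)
        (auto simp: sum_distrib_right mult.assoc Suc_diff_Suc Suc_diff_le intro!: sum.cong)
    also have "\<dots> = (\<Sum>i<j. \<Sum>k\<le>n. f i * (d * (- g (Suc (Suc (j - Suc i + k))) * V k)))"
      by (rule sum.swap)
    also have "\<dots> = (\<Sum>i<j. f i * (d * (\<Sum>k\<le>n. - g (Suc (Suc (j - Suc i + k))) * V k)))"
      by (simp only: sum_distrib_left)
    also have "\<dots> = (\<Sum>i<j. if i = 0 then if j = Suc n then f 0 * (d * E) else 0 else 0)"
    proof (intro sum.cong refl)
      fix i assume i: "i \<in> {..<j}"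
      have "j - Suc i \<le> n" using j by simp
      from E[OF this] show "f i * (d * (\<Sum>k\<le>n. - g (Suc (Suc (j - Suc i + k))) * V k)) =
          (if i = 0 then if j = Suc n then f 0 * (d * E) else 0 else 0)"
        using i j by (simp only:) auto
    qed
    also have "\<dots> = (if j = Suc n then E else 0)"
      using PE by (cases j) (simp_all add: f0_d flip: mult.assoc)
    finally show ?thesis .
  qed
  thus ?thesis using W(1) by blast
qed

end

section \<open>Dependence on finitely many terms, and the Stieltjes classes\<close>

lemma block_hankel_cong: "(\<And>i. i \<le> 2 * n \<Longrightarrow> s i = s' i) \<Longrightarrow> block_hankel q s n = block_hankel q s' n"
proof -
  assume eq: "\<And>i. i \<le> 2 * n \<Longrightarrow> s i = s' i"
  have less: "a div q \<le> n" if "a < Suc n * q" for a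
    using that by (metis less_Suc_eq_le less_mult_imp_div_less)
  show ?thesis unfolding block_hankel_def
  proof (rule cong_mat)
    fix a b assume "a < Suc n * q" "b < Suc n * q"
    hence "a div q + b div q \<le> 2 * n" using less[of a] less[of b] by simp
    thus "(\<lambda>(a, b). s (a div q + b div q) $$ (a mod q, b mod q)) (a, b) =
        (\<lambda>(a, b). s' (a div q + b div q) $$ (a mod q, b mod q)) (a, b)" by (simp add: eq)
  qed simp_all
qed

lemma hankel_schur_compl_cong:
  assumes "\<And>i. i \<le> 2 * n \<Longrightarrow> s i = s' i"
  shows "hankel_schur_compl q s n = hankel_schur_compl q s' n"
proof (cases n)
  case 0
  thus ?thesis using assms by (simp add: hankel_schur_compl_def)
next
  case (Suc m)
  have "block_hankel q s m = block_hankel q s' m"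
    by (rule block_hankel_cong) (use assms Suc in simp)
  moreover have "s (n + a div q) = s' (n + a div q)" if "a < n * q" for a
    using less_mult_imp_div_less[OF that] by (intro assms) simp
  hence "block_row q s n n = block_row q s' n n" "block_col q s n n = block_col q s' n n"
    unfolding block_row_def block_col_def by (auto intro!: cong_mat)
  ultimately show ?thesis using assms[of "2 * n"] Suc by (simp add: hankel_schur_compl_def)
qed

lemma stieltjes_param_cong:
  assumes "\<And>i. i \<le> j \<Longrightarrow> s i = s' i"
  shows "stieltjes_param q \<alpha> s j = stieltjes_param q \<alpha> s' j"
proof (cases "even j")
  case True
  thus ?thesis unfolding stieltjes_param_def using assms
    by (auto intro!: hankel_schur_compl_cong)
next
  case False
  hence "shifted \<alpha> s i = shifted \<alpha> s' i" if "i \<le> 2 * (j div 2)" for i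
  proof -
    have "Suc i \<le> j" using that False by presburger
    thus ?thesis using assms by (simp add: shifted_def)
  qed
  hence "hankel_schur_compl q (shifted \<alpha> s) (j div 2) = hankel_schur_compl q (shifted \<alpha> s') (j div 2)"
    by (rule hankel_schur_compl_cong)
  thus ?thesis using False by (simp add: stieltjes_param_def)
qed

lemma reciprocal_cong:
  assumes "\<And>i. i \<le> j \<Longrightarrow> u i = u' i"
  shows "reciprocal q u j = reciprocal q u' j"
  using assms
proof (induction j rule: less_induct)
  case (less j)
  have "reciprocal q u l = reciprocal q u' l" if "l < j" for l
    using that less by simp
  hence "mat q q (\<lambda>(a, b). \<Sum>l<j. (u (j - l) * reciprocal q u l) $$ (a, b)) =
      mat q q (\<lambda>(a, b). \<Sum>l<j. (u' (j - l) * reciprocal q u' l) $$ (a, b))"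
    using less.prems by (intro cong_mat) (auto intro!: sum.cong)
  thus ?case using less.prems[of 0] by (subst (1 2) reciprocal.simps) simp
qed

lemma schur_transform1_cong:
  assumes "\<And>i. i \<le> Suc j \<Longrightarrow> s i = s' i"
  shows "schur_transform1 q \<alpha> s j = schur_transform1 q \<alpha> s' j"
proof -
  have "reciprocal q (plus_transform q \<alpha> s) (Suc j) = reciprocal q (plus_transform q \<alpha> s') (Suc j)"
    by (rule reciprocal_cong) (simp add: plus_transform_def assms)
  thus ?thesis using assms[of 0] by (simp add: schur_transform1_def)
qed

lemma K_ge_fin_iff:
  assumes "1 \<le> m"
  shows "s \<in> K_ge_fin q m \<alpha> \<longleftrightarrow> (\<forall>j\<le>m. s j \<in> carrier_mat q q) \<and>
    nonneg_hermitian (block_hankel q s (m div 2)) \<and>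
    nonneg_hermitian (block_hankel q (shifted \<alpha> s) ((m - 1) div 2))"
proof (cases "even m")
  case True
  then obtain n where n: "m = 2 * n" by blast
  with assms have "1 \<le> n" by simp
  moreover have "(2 * n - 1) div 2 = n - 1" by presburger
  moreover have "2 * n \<noteq> 2 * n' + 1" for n' by presburger
  ultimately show ?thesis unfolding K_ge_fin_def n by auto
next
  case False
  then obtain n where n: "m = 2 * n + 1" by (blast elim: oddE)
  moreover have "2 * n + 1 \<noteq> 2 * n'" for n' by presburger
  ultimately show ?thesis unfolding K_ge_fin_def n by auto
qed

section \<open>The transform of a sequence living on the range of its first term\<close>

lemma shifted_carrier: "s j \<in> carrier_mat q q \<Longrightarrow> s (Suc j) \<in> carrier_mat q q \<Longrightarrow> shifted \<alpha> s j \<in> carrier_mat q q"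
  by (simp add: shifted_def)

lemma emb_shifted:
  assumes "s j \<in> carrier_mat q q" "s (Suc j) \<in> carrier_mat q q"
  shows "emb (shifted \<alpha> s j) = emb (s (Suc j)) - scalar (of_real \<alpha>) * emb (s j)"
proof -
  have "emb (shifted \<alpha> s j) = emb ((- complex_of_real \<alpha>) \<cdot>\<^sub>m s j) + emb (s (Suc j))"
    unfolding shifted_def by (rule emb_add[of _ q q]) (use assms in auto)
  thus ?thesis by (simp add: emb_smult scalar_uminus)
qed

lemma hankel_schur_compl_carrier:
  assumes "s (2 * n) \<in> carrier_mat q q"
  shows "hankel_schur_compl q s n \<in> carrier_mat q q"
proof (cases n)
  case (Suc m)
  have "block_row q s n n * moore_penrose (block_hankel q s m) * block_col q s n n \<in> carrier_mat q q"
    by (auto simp: block_row_def block_col_def)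
  thus ?thesis using Suc by (auto simp: hankel_schur_compl_def intro: minus_carrier_mat)
qed (use assms in \<open>simp add: hankel_schur_compl_def\<close>)

lemma emb_mat_sum:
  assumes "finite L" "\<And>l. l \<in> L \<Longrightarrow> A l \<in> carrier_mat q q"
  shows "emb (mat q q (\<lambda>(a, b). \<Sum>l\<in>L. A l $$ (a, b))) = (\<Sum>l\<in>L. emb (A l))"
proof (rule rcf_eqI)
  fix i j
  have "entry (\<Sum>l\<in>L. emb (A l)) i j = (\<Sum>l\<in>L. if i < q \<and> j < q then A l $$ (i, j) else 0)"
    unfolding entry_sum using assms(2) by (intro sum.cong) (auto simp: entry_emb)
  thus "entry (emb (mat q q (\<lambda>(a, b). \<Sum>l\<in>L. A l $$ (a, b)))) i j = entry (\<Sum>l\<in>L. emb (A l)) i j"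
    by (cases "i < q \<and> j < q") (auto simp: entry_emb)
qed

lemma reciprocal_carrier:
  assumes "\<And>j. u j \<in> carrier_mat q q" "star (emb (u 0)) = emb (u 0)"
  shows "reciprocal q u j \<in> carrier_mat q q"
  using moore_penrose_hermitian(1)[OF assms(1) assms(2)]
  by (subst reciprocal.simps) auto

lemma emb_reciprocal_Suc:
  assumes "\<And>j. u j \<in> carrier_mat q q" "star (emb (u 0)) = emb (u 0)"
  shows "emb (reciprocal q u (Suc j)) =
    - (emb (moore_penrose (u 0)) * (\<Sum>l<Suc j. emb (u (Suc j - l)) * emb (reciprocal q u l)))"
proof -
  have c: "moore_penrose (u 0) \<in> carrier_mat q q" using moore_penrose_hermitian(1) assms by blast
  note r = reciprocal_carrier[of u q, OF assms]
  have "emb (reciprocal q u (Suc j)) = - (emb (moore_penrose (u 0)) *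
      emb (mat q q (\<lambda>(a, b). \<Sum>l<Suc j. (u (Suc j - l) * reciprocal q u l) $$ (a, b))))"
    using c by (subst reciprocal.simps) (simp add: emb_mult emb_uminus)
  also have "emb (mat q q (\<lambda>(a, b). \<Sum>l<Suc j. (u (Suc j - l) * reciprocal q u l) $$ (a, b))) =
      (\<Sum>l<Suc j. emb (u (Suc j - l) * reciprocal q u l))"
    by (rule emb_mat_sum) (use assms(1) r in \<open>auto intro!: mult_carrier_mat\<close>)
  also have "\<dots> = (\<Sum>l<Suc j. emb (u (Suc j - l)) * emb (reciprocal q u l))"
    using assms(1) r by (intro sum.cong refl emb_mult) (metis carrier_matD)
  finally show ?thesis .
qed

text \<open>The last condition says that the null space of \<open>s\<^sub>0\<close> is contained in that of \<open>s\<^sub>j\<close>. By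
  Hermiticity the range of \<open>s\<^sub>j\<close> is then contained in that of \<open>s\<^sub>0\<close>. There is no bound on \<open>j\<close>, so that
  identities of power series hold without truncation.\<close>

definition regular :: "nat \<Rightarrow> (nat \<Rightarrow> complex mat) \<Rightarrow> bool" where
  "regular q s \<longleftrightarrow> (\<forall>j. s j \<in> carrier_mat q q \<and> star (emb (s j)) = emb (s j) \<and>
     emb (s j) * (emb (moore_penrose (s 0)) * emb (s 0)) = emb (s j))"

locale regular_sequence =
  fixes q :: nat and \<alpha> :: real and s :: "nat \<Rightarrow> complex mat"
  assumes q: "0 < q" and reg: "regular q s"
begin

abbreviation (input) a where "a j \<equiv> emb (s j)"
abbreviation (input) d where "d \<equiv> emb (moore_penrose (s 0))"
abbreviation (input) P where "P \<equiv> a 0 * d"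
abbreviation (input) u where "u \<equiv> plus_transform q \<alpha> s"
abbreviation (input) r where "r j \<equiv> emb (reciprocal q u j)"
abbreviation (input) t where "t \<equiv> schur_transform1 q \<alpha> s"
abbreviation (input) al where "al \<equiv> scalar (of_real \<alpha>)"

lemma s_carrier: "s j \<in> carrier_mat q q"
  and a_star: "star (a j) = a j"
  using reg by (auto simp: regular_def)

lemma mp: "mp_inverse (a 0) d"
  using moore_penrose_hermitian(2)[OF s_carrier a_star] .

lemma d_star: "star d = d" and d_a0: "d * a 0 = P"
  using mp_inverse_hermitian[OF mp a_star] by auto

lemma a_P: "a j * P = a j"
  using reg d_a0 by (simp add: regular_def)

lemma P_star: "star P = P"
  using mp by (simp add: mp_inverse_def)

lemma P_a: "P * a j = a j"
  using arg_cong[OF a_P, of star j] by (simp only: star_times[of "a j"] P_star a_star)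

lemma P_d: "P * d = d"
  using mp by (simp add: mp_inverse_def flip: d_a0)

lemma u_carrier: "u j \<in> carrier_mat q q"
  using s_carrier by (simp add: plus_transform_def)

lemma u_0: "u 0 = s 0"
  using s_carrier[of 0] by (auto simp: plus_transform_def intro!: eq_matI)

lemma emb_u_Suc: "emb (u (Suc j)) = a (Suc j) - al * a j"
proof -
  have "emb (u (Suc j)) = emb ((- complex_of_real \<alpha>) \<cdot>\<^sub>m s j) + a (Suc j)"
    unfolding plus_transform_def by (simp, rule emb_add[of _ q q]) (use s_carrier in auto)
  thus ?thesis by (simp add: emb_smult scalar_uminus)
qed

lemma u_star: "star (emb (u j)) = emb (u j)"
  by (cases j) (simp_all add: u_0 a_star emb_u_Suc scalar_commute)

lemma u_P: "emb (u j) * P = emb (u j)"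
  by (cases j) (simp_all only: u_0 a_P emb_u_Suc left_diff_distrib mult.assoc[of al] a_P)

lemma P_u: "P * emb (u j) = emb (u j)"
  using arg_cong[OF u_P, of star j] by (simp only: star_times[of "emb (u j)"] P_star u_star)

lemma r_carrier: "reciprocal q u j \<in> carrier_mat q q"
  using reciprocal_carrier[of u q, OF u_carrier u_star] .

lemma r_0: "r 0 = d"
  by (subst reciprocal.simps) (simp add: u_0)

lemma r_Suc: "r (Suc j) = - (d * (\<Sum>l<Suc j. emb (u (Suc j - l)) * r l))"
  using emb_reciprocal_Suc[of u q j, OF u_carrier u_star] by (simp only: u_0)

lemma P_r: "P * r j = r j"
  by (cases j) (simp_all only: r_0 P_d r_Suc mult_minus_right mult.assoc[symmetric])

text \<open>Under the range condition the reciprocal sequence is a right inverse relative to \<open>P\<close>: multiplying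
  the recursion by \<open>u\<^sub>0\<close> turns \<open>u\<^sub>0 u\<^sub>0\<^sup>\<dagger>\<close> into \<open>P\<close>, which acts as identity on every \<open>u\<^sub>j\<close>.\<close>

lemma u_r: "Abs_fps (\<lambda>j. emb (u j)) * Abs_fps r = fps_const P"
proof (rule fps_ext)
  fix j
  have e: "fps_nth (Abs_fps (\<lambda>j. emb (u j)) * Abs_fps r) j = (\<Sum>l\<le>j. emb (u (j - l)) * r l)"
    unfolding fps_mult_nth
    by (rule sum.reindex_bij_witness[of _ "\<lambda>i. j - i" "\<lambda>i. j - i"]) auto
  show "fps_nth (Abs_fps (\<lambda>j. emb (u j)) * Abs_fps r) j = fps_nth (fps_const P) j"
  proof (cases j)
    case 0
    thus ?thesis by (simp add: u_0 r_0)
  next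
    case (Suc m)
    let ?S = "\<Sum>l<Suc m. emb (u (Suc m - l)) * r l"
    have "(\<Sum>l\<le>Suc m. emb (u (Suc m - l)) * r l) = ?S + a 0 * r (Suc m)"
      unfolding lessThan_Suc_atMost[symmetric] sum.lessThan_Suc[of _ "Suc m"] by (simp add: u_0)
    also have "a 0 * r (Suc m) = - (P * ?S)"
      unfolding r_Suc[of m] by (simp only: mult_minus_right mult.assoc)
    also have "P * ?S = ?S"
      unfolding sum_distrib_left mult.assoc[symmetric] P_u ..
    finally show ?thesis unfolding e by (simp add: Suc)
  qed
qed

text \<open>The adjoint of a right inverse of the Hermitian series \<open>U\<close> is a left inverse of \<open>U\<close>, and one-sided
  inverses on both sides coincide.\<close>

lemma r_star: "star (r j) = r j"
proof -
  let ?U = "Abs_fps (\<lambda>j. emb (u j))" and ?R = "Abs_fps r"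
  have U: "star_fps ?U = ?U" by (simp add: star_fps_Abs u_star)
  have PR: "fps_const P * ?R = ?R" by (rule fps_ext) (simp add: P_r)
  hence RP: "star_fps ?R * fps_const P = star_fps ?R"
    by (metis star_fps_mult star_fps_const P_star)
  have "star_fps ?R * ?U = fps_const P"
    using arg_cong[OF u_r, of star_fps] by (simp only: star_fps_mult U star_fps_const P_star)
  hence "star_fps ?R * (?U * ?R) = fps_const P * ?R" by (simp only: mult.assoc[symmetric])
  hence "star_fps ?R = ?R" by (simp only: u_r RP PR)
  from arg_cong[OF this, of "\<lambda>F. fps_nth F j"] show ?thesis by (simp add: star_fps_def)
qed

lemma t_carrier: "t j \<in> carrier_mat q q"
  unfolding schur_transform1_def using s_carrier[of 0] r_carrier[of "Suc j"] by auto

lemma emb_t: "emb (t j) = - (a 0 * r (Suc j) * a 0)"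
  unfolding schur_transform1_def using s_carrier[of 0] r_carrier[of "Suc j"]
  by (auto simp: emb_mult emb_uminus mult.assoc)

text \<open>The coefficients of \<open>V = s\<^sub>0 - x T\<close>.\<close>

definition v where "v j = a 0 * r j * a 0"

lemma v_0: "v 0 = a 0"
  using mp by (simp add: v_def r_0 mp_inverse_def)

lemma v_Suc: "v (Suc j) = - emb (t j)"
  by (simp add: v_def emb_t)

lemma v_star: "star (v j) = v j"
  by (simp add: v_def a_star r_star mult.assoc)

lemma P_v: "P * v j = v j"
  unfolding v_def mult.assoc[symmetric] P_a ..

lemma u_v: "Abs_fps (\<lambda>j. emb (u j)) * fps_const d * Abs_fps v = fps_const (a 0)"
proof -
  have "fps_const d * Abs_fps v = Abs_fps r * fps_const (a 0)"
  proof (rule fps_ext)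
    fix n
    have "d * v n = P * r n * a 0" by (simp add: v_def d_a0 flip: mult.assoc)
    thus "fps_nth (fps_const d * Abs_fps v) n = fps_nth (Abs_fps r * fps_const (a 0)) n"
      by (simp add: P_r)
  qed
  hence "Abs_fps (\<lambda>j. emb (u j)) * fps_const d * Abs_fps v = fps_const P * fps_const (a 0)"
    by (simp only: mult.assoc u_r[symmetric])
  thus ?thesis by (simp add: P_a)
qed

lemma pair_u_v: "reciprocal_pair (\<lambda>j. emb (u j)) v d P"
  by unfold_locales
    (simp_all only: u_star v_star d_star v_0 u_0 d_a0 u_P P_v u_v)

text \<open>The coefficients of \<open>W = (1 - \<alpha> x) V\<close>.\<close>

definition w where "w j = v j - (case j of 0 \<Rightarrow> 0 | Suc i \<Rightarrow> al * v i)"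

text \<open>The central factor \<open>1 - \<alpha> x\<close> moves from \<open>U = (1 - \<alpha> x) S\<close> to \<open>V\<close>.\<close>

lemma pair_a_w: "reciprocal_pair a w d P"
proof unfold_locales
  fix j
  show "star (a j) = a j" "star d = d" "a 0 * d = P" "d * a 0 = P" "a j * P = a j"
    by (simp_all only: a_star d_star d_a0 a_P)
  show "w 0 = a 0" by (simp add: w_def v_0)
  show "star (w j) = w j" by (simp add: w_def v_star scalar_commute split: nat.split)
  show "P * w j = w j"
  proof (cases j)
    case (Suc i)
    have "P * (al * v i) = al * (P * v i)"
      by (simp only: mult.assoc[symmetric] scalar_commute)
    thus ?thesis by (simp only: Suc w_def nat.case right_diff_distrib P_v)
  qed (simp only: w_def nat.case diff_0_right P_v)
  let ?A = "Abs_fps a" and ?V = "Abs_fps v" and ?U = "Abs_fps (\<lambda>j. emb (u j))" and ?D = "fps_const d"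
  let ?Z = "1 - fps_const al * fps_X :: rcf fps"
  have Z: "F * ?Z = ?Z * F" for F
  proof -
    have "F * fps_const al = fps_const al * F"
      by (rule fps_ext) (simp add: scalar_commute)
    hence "F * (fps_const al * fps_X) = fps_const al * fps_X * F"
      by (metis mult.assoc fps_mult_fps_X_commute)
    thus ?thesis by (simp add: left_diff_distrib right_diff_distrib)
  qed
  have nth: "fps_nth (?Z * F) n = fps_nth F n - (case n of 0 \<Rightarrow> 0 | Suc i \<Rightarrow> al * fps_nth F i)" for F n
    by (cases n) (simp_all add: left_diff_distrib mult.assoc)
  have U: "?U = ?Z * ?A"
  proof (rule fps_ext)
    fix n show "fps_nth ?U n = fps_nth (?Z * ?A) n"
      unfolding nth by (cases n) (simp_all add: u_0 emb_u_Suc)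
  qed
  have W: "Abs_fps w = ?Z * ?V"
    by (rule fps_ext) (simp only: nth fps_nth_Abs_fps w_def)
  have "?A * ?D * Abs_fps w = ?A * ?D * ?Z * ?V" by (simp only: W mult.assoc)
  also have "?A * ?D * ?Z = ?Z * ?A * ?D" by (simp only: Z mult.assoc)
  finally show "?A * ?D * Abs_fps w = fps_const (a 0)" by (simp only: U[symmetric] u_v)
qed

lemma emb_u_shifted: "emb (u (Suc j)) = emb (shifted \<alpha> s j)"
  using emb_shifted[of s j q \<alpha>] s_carrier by (simp add: emb_u_Suc)

lemma w_shifted: "w (Suc (Suc j)) = - emb (shifted \<alpha> t j)"
  using emb_shifted[of t j q \<alpha>] t_carrier by (simp add: w_def v_Suc)

lemma shifted_s_carrier: "shifted \<alpha> s j \<in> carrier_mat q q"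
  and shifted_t_carrier: "shifted \<alpha> t j \<in> carrier_mat q q"
  using s_carrier t_carrier by (auto intro: shifted_carrier)

lemma t_herm: "star (emb (t j)) = emb (t j)"
  using v_star[of "Suc j"] by (simp add: v_Suc)

lemma shifted_t_herm: "star (emb (shifted \<alpha> t j)) = emb (shifted \<alpha> t j)"
  using emb_shifted[of t j q \<alpha>] t_carrier by (simp add: t_herm scalar_commute)

lemma shifted_s_herm: "star (emb (shifted \<alpha> s j)) = emb (shifted \<alpha> s j)"
  using u_star[of "Suc j"] by (simp add: emb_u_shifted)

lemma nonneg_iff:
  assumes "\<And>j. x j \<in> carrier_mat q q" "\<And>j. star (emb (x j)) = emb (x j)"
  shows "nonneg_hermitian (block_hankel q x n) \<longleftrightarrow> hankel_nonneg (\<lambda>j. emb (x j)) n"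
  using nonneg_block_hankel_iff[of q n x] q assms by (simp add: hermitian_upto_def)

lemma schur_compl_eqI:
  assumes x: "\<And>j. x j \<in> carrier_mat q q" "\<And>j. star (emb (x j)) = emb (x j)"
    and W: "W n = 1" "\<And>j. j \<le> n \<Longrightarrow> (\<Sum>k\<le>n. emb (x (j + k)) * W k) = (if j = n then E else 0)"
  shows "emb (hankel_schur_compl q x n) = E"
proof -
  have "emb (hankel_schur_compl q x n) = (\<Sum>k\<le>n. emb (x (n + k)) * W k)"
    by (rule schur_compl_by_solution[OF q]) (use x W in \<open>auto simp: hermitian_upto_def\<close>)
  thus ?thesis using W(2)[of n] by simp
qed

lemma schur_compl_ex:
  assumes x: "\<And>j. x j \<in> carrier_mat q q" "\<And>j. star (emb (x j)) = emb (x j)"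
    and pos: "hankel_nonneg (\<lambda>j. emb (x j)) n"
  shows "\<exists>W. W n = 1 \<and> (\<forall>j\<le>n. (\<Sum>k\<le>n. emb (x (j + k)) * W k) =
    (if j = n then emb (hankel_schur_compl q x n) else 0))"
proof -
  obtain W where W: "W n = 1" "\<And>j. j < n \<Longrightarrow> (\<Sum>k\<le>n. emb (x (j + k)) * W k) = 0"
    using schur_solution_exists[of q n x] q x pos by (auto simp: hermitian_upto_def)
  have "emb (hankel_schur_compl q x n) = (\<Sum>k\<le>n. emb (x (n + k)) * W k)"
    by (rule schur_compl_by_solution[OF q]) (use x W in \<open>auto simp: hermitian_upto_def\<close>)
  thus ?thesis using W by (intro exI[of _ W]) auto
qed

text \<open>The pair \<open>(U, V)\<close> compares the Hankel matrix of \<open>(s\<^bsub>\<alpha>,j\<^esub>)\<close> with that of \<open>(t\<^sub>j)\<close>.\<close>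

lemma transform_shifted_step:
  assumes "nonneg_hermitian (block_hankel q (shifted \<alpha> s) n)"
  shows "nonneg_hermitian (block_hankel q t n)"
    and "hankel_schur_compl q (shifted \<alpha> s) n = hankel_schur_compl q t n"
proof -
  interpret reciprocal_pair "\<lambda>j. emb (u j)" v d P by (rule pair_u_v)
  have "hankel_nonneg (\<lambda>j. emb (u (Suc j))) n"
    using assms unfolding nonneg_iff[of "shifted \<alpha> s" n, OF shifted_s_carrier shifted_s_herm] emb_u_shifted .
  from hankel_nonneg_shift[OF this] have pos: "hankel_nonneg (\<lambda>j. emb (t j)) n" by (simp add: v_Suc)
  thus "nonneg_hermitian (block_hankel q t n)"
    unfolding nonneg_iff[of t n, OF t_carrier t_herm] .
  let ?E = "emb (hankel_schur_compl q t n)"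
  obtain V where V: "V n = 1" "\<And>j. j \<le> n \<Longrightarrow> (\<Sum>k\<le>n. emb (t (j + k)) * V k) = (if j = n then ?E else 0)"
    using schur_compl_ex[of t n, OF t_carrier t_herm pos] by blast
  obtain W where W: "W n = 1"
    "\<And>j. j \<le> n \<Longrightarrow> (\<Sum>k\<le>n. emb (u (Suc (j + k))) * W k) = (if j = n then ?E else 0)"
    using schur_solution_shift[of V n ?E] V by (auto simp: v_Suc)
  have "emb (hankel_schur_compl q (shifted \<alpha> s) n) = ?E"
    by (rule schur_compl_eqI[of _ W]) (use W shifted_s_carrier shifted_s_herm in \<open>auto simp: emb_u_shifted\<close>)
  thus "hankel_schur_compl q (shifted \<alpha> s) n = hankel_schur_compl q t n"
    by (rule emb_inject[rotated 2]) (auto intro!: hankel_schur_compl_carrier shifted_s_carrier t_carrier)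
qed

text \<open>The pair \<open>(S, W)\<close> compares the Hankel matrix of \<open>(s\<^sub>j)\<close> with that of \<open>(t\<^bsub>\<alpha>,j\<^esub>)\<close>, which is one block
  smaller.\<close>

lemma transform_unshifted_step:
  assumes "nonneg_hermitian (block_hankel q s (Suc n))"
  shows "nonneg_hermitian (block_hankel q (shifted \<alpha> t) n)"
    and "hankel_schur_compl q s (Suc n) = hankel_schur_compl q (shifted \<alpha> t) n"
proof -
  interpret reciprocal_pair a w d P by (rule pair_a_w)
  have "hankel_nonneg a (Suc n)"
    using assms unfolding nonneg_iff[of s "Suc n", OF s_carrier a_star] .
  from hankel_nonneg_double_shift[OF this] have pos: "hankel_nonneg (\<lambda>j. emb (shifted \<alpha> t j)) n" by (simp add: w_shifted)
  thus "nonneg_hermitian (block_hankel q (shifted \<alpha> t) n)"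
    unfolding nonneg_iff[of "shifted \<alpha> t" n, OF shifted_t_carrier shifted_t_herm] .
  let ?E = "emb (hankel_schur_compl q (shifted \<alpha> t) n)"
  obtain V where V: "V n = 1"
    "\<And>j. j \<le> n \<Longrightarrow> (\<Sum>k\<le>n. emb (shifted \<alpha> t (j + k)) * V k) = (if j = n then ?E else 0)"
    using schur_compl_ex[of "shifted \<alpha> t" n, OF shifted_t_carrier shifted_t_herm pos] by blast
  obtain W where W: "W (Suc n) = 1"
    "\<And>j. j \<le> Suc n \<Longrightarrow> (\<Sum>k\<le>Suc n. a (j + k) * W k) = (if j = Suc n then ?E else 0)"
    using schur_solution_double_shift[of V n ?E] V by (auto simp: w_shifted)
  have "emb (hankel_schur_compl q s (Suc n)) = ?E"
    by (rule schur_compl_eqI[of _ W]) (use W s_carrier a_star in auto)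
  thus "hankel_schur_compl q s (Suc n) = hankel_schur_compl q (shifted \<alpha> t) n"
    by (rule emb_inject[rotated 2]) (auto intro!: hankel_schur_compl_carrier s_carrier shifted_t_carrier)
qed

end

section \<open>Enforcing the range condition on the appended term\<close>

text \<open>A null vector of the diagonal block \<open>h\<^bsub>2i\<^esub>\<close>, placed in block \<open>i\<close>, annihilates the form.
  Hence row \<open>i + 1\<close> of the Hankel matrix, whose entry there is \<open>h\<^bsub>2i+1\<^esub>\<close>, annihilates it too.\<close>

lemma hankel_null_next:
  assumes h: "hermitian_upto h (2 * n)" and pos: "hankel_nonneg h n" and i: "Suc i \<le> n" and null: "h (2 * i) * x = 0"
  shows "h (Suc (2 * i)) * x = 0"
proof -
  let ?p = "\<lambda>k. if k = i then x else 0"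
  have row: "(\<Sum>k\<le>n. h (j + k) * ?p k) = h (j + i) * x" for j
  proof -
    have "(\<Sum>k\<le>n. h (j + k) * ?p k) = (\<Sum>k\<le>n. if k = i then h (j + i) * x else 0)"
      by (intro sum.cong) auto
    thus ?thesis using i by simp
  qed
  have "hankel_form h n ?p = (\<Sum>j\<le>n. star (?p j) * (\<Sum>k\<le>n. h (j + k) * ?p k))"
    by (simp add: hankel_form_def sum_distrib_left mult.assoc)
  also have "\<dots> = 0"
    unfolding row using null by (intro sum.neutral) (auto simp: mult_2)
  finally have "(\<Sum>k\<le>n. h (Suc i + k) * ?p k) = 0"
    by (rule hankel_form_null[OF h pos]) (rule i)
  thus ?thesis unfolding row by (simp add: mult_2)
qed

text \<open>Null vectors of \<open>s\<^sub>0\<close> propagate along the sequence: from an even index to the next odd one by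
  the Hankel matrix of \<open>(s\<^sub>j)\<close>, and from an odd index to the next even one by that of \<open>(s\<^bsub>\<alpha>,j\<^esub>)\<close>. The
  last term \<open>s\<^sub>m\<close> is out of reach, because it occurs only in the last diagonal block of one of them.\<close>

lemma stieltjes_null:
  fixes al :: rcf
  assumes ha: "hermitian_upto a (2 * (m div 2))" and pa: "hankel_nonneg a (m div 2)"
    and hb: "hermitian_upto (\<lambda>j. a (Suc j) - al * a j) (2 * ((m - 1) div 2))"
    and pb: "hankel_nonneg (\<lambda>j. a (Suc j) - al * a j) ((m - 1) div 2)"
    and null: "a 0 * x = 0" and j: "j < m"
  shows "a j * x = 0"
  using j
proof (induction j rule: less_induct)
  case (less j)
  show ?case
  proof (cases j)
    case 0
    thus ?thesis using null by simp
  next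
    case (Suc l)
    show ?thesis
    proof (cases "even l")
      case True
      then obtain i where i: "l = 2 * i" by blast
      have "a (Suc (2 * i)) * x = 0"
        by (rule hankel_null_next[OF ha pa]) (use less Suc i in auto)
      thus ?thesis by (simp add: Suc i)
    next
      case False
      then obtain i where i: "l = Suc (2 * i)" by (metis oddE Suc_eq_plus1)
      have "a (2 * i) * x = 0" "a (Suc (2 * i)) * x = 0"
        using less Suc i by auto
      moreover from this have "(a (Suc (Suc (2 * i))) - al * a (Suc (2 * i))) * x = 0"
        by (intro hankel_null_next[OF hb pb])
          (use less.prems Suc i in \<open>auto simp: left_diff_distrib mult.assoc\<close>)
      ultimately show ?thesis by (simp add: Suc i left_diff_distrib mult.assoc)
    qed
  qed
qed

text \<open>Compression by \<open>P\<close> is a congruence by the block diagonal matrix of \<open>P\<close>, so it preserves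
  nonnegativity. It fixes \<open>s\<^sub>0, \<dots>, s\<^bsub>m-1\<^esub>\<close>, which satisfy the range condition by
  \<open>stieltjes_null\<close>. Terms after \<open>s\<^sub>m\<close> are set to zero.\<close>

lemma regularise:
  assumes q: "0 < q" and m: "1 \<le> m" and s: "s \<in> K_ge_fin q m \<alpha>"
  shows "\<exists>s'. regular q s' \<and> s' \<in> K_ge_fin q m \<alpha> \<and> (\<forall>j<m. s' j = s j)"
proof -
  let ?al = "scalar (of_real \<alpha>)"
  define a where "a j = emb (s j)" for j
  have c: "s j \<in> carrier_mat q q" if "j \<le> m" for j
    using s that unfolding K_ge_fin_iff[OF m] by blast
  have cs: "shifted \<alpha> s j \<in> carrier_mat q q" if "j \<le> 2 * ((m - 1) div 2)" for j
    by (intro shifted_carrier c) (use that m in auto)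
  have sh: "emb (shifted \<alpha> s j) = a (Suc j) - ?al * a j" if "j \<le> 2 * ((m - 1) div 2)" for j
    unfolding a_def by (intro emb_shifted[of s j q] c) (use that m in auto)
  have ha: "hermitian_upto a (2 * (m div 2))" and pa: "hankel_nonneg a (m div 2)"
    using s c unfolding K_ge_fin_iff[OF m] a_def
    by (subst (asm) nonneg_block_hankel_iff[OF q]; force)+
  have "hermitian_upto (\<lambda>j. emb (shifted \<alpha> s j)) (2 * ((m - 1) div 2))"
    and "hankel_nonneg (\<lambda>j. emb (shifted \<alpha> s j)) ((m - 1) div 2)"
    using s cs unfolding K_ge_fin_iff[OF m]
    by (subst (asm) (2) nonneg_block_hankel_iff[OF q]; force)+
  hence hb: "hermitian_upto (\<lambda>j. a (Suc j) - ?al * a j) (2 * ((m - 1) div 2))"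
    and pb: "hankel_nonneg (\<lambda>j. a (Suc j) - ?al * a j) ((m - 1) div 2)"
    using hankel_form_cong[of "(m - 1) div 2" "\<lambda>j. emb (shifted \<alpha> s j)" "\<lambda>j. a (Suc j) - ?al * a j"] sh
    by (auto simp: hermitian_upto_def hankel_nonneg_def)
  \<comment> \<open>For odd \<open>m\<close> the last term occurs only in the Hankel matrix of the shifted sequence.\<close>
  have a_star: "star (a j) = a j" if "j \<le> m" for j
  proof (cases "j \<le> 2 * (m div 2)")
    case True
    thus ?thesis using ha by (simp add: hermitian_upto_def)
  next
    case False
    then obtain i where ji: "j = Suc i" by (cases j) auto
    hence i: "j = Suc i" "i \<le> 2 * ((m - 1) div 2)" "i \<le> 2 * (m div 2)"
      using False that by presburger+
    have "star (a j - ?al * a i) = a j - ?al * a i" using hb i by (simp add: hermitian_upto_def)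
    moreover have "star (a i) = a i" using ha i by (simp add: hermitian_upto_def)
    ultimately show ?thesis by (simp add: scalar_commute)
  qed
  have a_idn: "idn q * a j = a j" "a j * idn q = a j" if "j \<le> m" for j
    using c[OF that] by (auto simp: a_def idn_emb emb_idn)
  define d where "d = emb (moore_penrose (s 0))"
  have mp: "mp_inverse (a 0) d"
    unfolding a_def d_def using moore_penrose_hermitian(2)[OF c[of 0]] a_star[of 0] by (simp add: a_def)
  define P where "P = a 0 * d"
  have dP: "d * a 0 = P" using mp_inverse_hermitian[OF mp a_star] by (simp add: P_def)
  have P_star: "star P = P" using mp by (simp add: P_def mp_inverse_def)
  have a0P: "a 0 * P = a 0" using mp by (simp add: mp_inverse_def mult.assoc flip: dP)
  have PP: "P * P = P" unfolding P_def using mp by (simp add: mp_inverse_def flip: mult.assoc)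
  have aP: "a j * P = a j" if "j < m" for j
  proof -
    have "a j * (1 - P) = 0"
      by (rule stieltjes_null[OF ha pa hb pb _ that]) (simp add: right_diff_distrib a0P)
    thus ?thesis by (simp add: right_diff_distrib)
  qed
  have Pa: "P * a j = a j" if "j < m" for j
    using arg_cong[OF aP[OF that], of star] a_star[of j] that by (simp add: P_star)
  have P_idn: "idn q * P = P" "P * idn q = P"
  proof -
    show "idn q * P = P" unfolding P_def using a_idn[of 0] by (simp flip: mult.assoc)
    from arg_cong[OF this, of star] show "P * idn q = P" by (simp add: P_star)
  qed
  define s' where "s' j = (if j \<le> m then corner q q (P * a j * P) else 0\<^sub>m q q)" for j
  have c': "s' j \<in> carrier_mat q q" for j by (simp add: s'_def)
  have emb': "emb (s' j) = (if j \<le> m then P * a j * P else 0)" for j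
    using P_idn by (simp add: s'_def emb_corner emb_zero mult.assoc) (simp flip: mult.assoc)
  have eq: "s' j = s j" if "j < m" for j
  proof (rule emb_inject[OF c' c])
    show "emb (s' j) = emb (s j)" using that by (simp add: emb' aP Pa) (simp add: a_def)
  qed (use that in simp)
  have "s' 0 = s 0" using eq m by simp
  hence reg: "regular q s'"
    unfolding regular_def using a_star c'
    by (auto simp: emb' P_star mult.assoc dP PP simp flip: d_def a_def)
  have "hermitian_upto (\<lambda>j. emb (s' j)) n" for n
    using reg by (simp add: hermitian_upto_def regular_def)
  have compress: "hankel_nonneg (\<lambda>j. P * b j * P) n" if "hankel_nonneg b n" for b n
    unfolding hankel_nonneg_def
  proof
    fix p :: "nat \<Rightarrow> rcf"
    have "hankel_form (\<lambda>j. P * b j * P) n p = hankel_form b n (\<lambda>k. P * p k)"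
      by (simp add: hankel_form_def P_star mult.assoc)
    thus "0 \<le> entry (hankel_form (\<lambda>j. P * b j * P) n p) 0 0" using that by (simp add: hankel_nonneg_def)
  qed
  have "nonneg_hermitian (block_hankel q s' (m div 2))"
  proof -
    have "hankel_form (\<lambda>j. emb (s' j)) (m div 2) = hankel_form (\<lambda>j. P * a j * P) (m div 2)"
    proof (rule hankel_form_cong)
      fix j assume "j \<le> 2 * (m div 2)"
      hence "j \<le> m" by presburger
      thus "emb (s' j) = P * a j * P" by (simp add: emb')
    qed
    hence "hankel_nonneg (\<lambda>j. emb (s' j)) (m div 2)" using compress[OF pa] by (simp add: hankel_nonneg_def)
    thus ?thesis
      using nonneg_block_hankel_iff[of q "m div 2" s'] q c' reg by (simp add: hermitian_upto_def regular_def)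
  qed
  moreover have "nonneg_hermitian (block_hankel q (shifted \<alpha> s') ((m - 1) div 2))"
  proof -
    have e: "emb (shifted \<alpha> s' j) = emb (s' (Suc j)) - ?al * emb (s' j)" for j
      using emb_shifted[of s' j q] c' by simp
    have "hankel_form (\<lambda>j. emb (shifted \<alpha> s' j)) ((m - 1) div 2) =
        hankel_form (\<lambda>j. P * (a (Suc j) - ?al * a j) * P) ((m - 1) div 2)"
    proof (rule hankel_form_cong)
      fix j assume "j \<le> 2 * ((m - 1) div 2)"
      hence "Suc j \<le> m" using m by auto
      moreover have "?al * (P * a j * P) = P * (?al * a j) * P"
        by (simp only: mult.assoc[symmetric] scalar_commute)
      ultimately show "emb (shifted \<alpha> s' j) = P * (a (Suc j) - ?al * a j) * P"
        unfolding e by (simp only: emb' if_True Suc_leD right_diff_distrib left_diff_distrib)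
    qed
    hence "hankel_nonneg (\<lambda>j. emb (shifted \<alpha> s' j)) ((m - 1) div 2)"
      using compress[OF pb] by (simp add: hankel_nonneg_def)
    moreover have "star (emb (shifted \<alpha> s' j)) = emb (shifted \<alpha> s' j)" for j
      using reg by (simp add: e regular_def scalar_commute)
    moreover have "shifted \<alpha> s' j \<in> carrier_mat q q" for j
      by (intro shifted_carrier c')
    ultimately show ?thesis
      using nonneg_block_hankel_iff[of q "(m - 1) div 2" "shifted \<alpha> s'"] q by (simp add: hermitian_upto_def)
  qed
  ultimately have "s' \<in> K_ge_fin q m \<alpha>" unfolding K_ge_fin_iff[OF m] using c' by blast
  with reg eq show ?thesis by blast
qed

section \<open>Iterating the transform\<close>

text \<open>Membership in \<open>K_ge_e\<close> for a finite index, phrased so that it depends only on the terms up to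
  \<open>m\<close>. The transform of the witness \<open>s'\<close> is then a witness for the transform of \<open>s\<close>.\<close>

definition extendable :: "nat \<Rightarrow> real \<Rightarrow> nat \<Rightarrow> (nat \<Rightarrow> complex mat) \<Rightarrow> bool" where
  "extendable q \<alpha> m s \<longleftrightarrow> (\<exists>s'. (\<forall>j\<le>m. s' j = s j) \<and> s' \<in> K_ge_fin q (Suc m) \<alpha>)"

text \<open>Once the witness is compressed, the odd and the even parameters are the two congruence steps,
  applied to leading principal blocks of its nonnegative Hankel matrices.\<close>

lemma schur_transform1_step:
  assumes q: "0 < q" and ext: "extendable q \<alpha> (Suc m) s"
  shows "extendable q \<alpha> m (schur_transform1 q \<alpha> s)"
    and "j \<le> m \<Longrightarrow> stieltjes_param q \<alpha> s (Suc j) = stieltjes_param q \<alpha> (schur_transform1 q \<alpha> s) j"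
proof -
  obtain s1 where s1: "\<And>j. j \<le> Suc m \<Longrightarrow> s1 j = s j" "s1 \<in> K_ge_fin q (Suc (Suc m)) \<alpha>"
    using ext unfolding extendable_def by blast
  obtain s' where reg: "regular q s'" and K: "s' \<in> K_ge_fin q (Suc (Suc m)) \<alpha>"
    and "\<And>j. j < Suc (Suc m) \<Longrightarrow> s' j = s1 j"
    using regularise[OF q _ s1(2)] by auto
  interpret regular_sequence q \<alpha> s' using q reg by unfold_locales
  from s1(1) \<open>\<And>j. j < Suc (Suc m) \<Longrightarrow> s' j = s1 j\<close> have eq: "s' j = s j" if "j \<le> Suc m" for j using that by simp
  let ?t = "schur_transform1 q \<alpha> s" and ?t' = "schur_transform1 q \<alpha> s'"
  have t_eq: "?t' j = ?t j" if "j \<le> m" for j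
    by (rule schur_transform1_cong) (use that eq in simp)
  have pos: "nonneg_hermitian (block_hankel q s' (Suc (m div 2)))"
    "nonneg_hermitian (block_hankel q (shifted \<alpha> s') (Suc m div 2))"
    using K K_ge_fin_iff[of "Suc (Suc m)" s' q \<alpha>] by simp_all
  have "?t' \<in> K_ge_fin q (Suc m) \<alpha>"
    using K_ge_fin_iff[of "Suc m" ?t' q \<alpha>] transform_shifted_step(1)[OF pos(2)] transform_unshifted_step(1)[OF pos(1)]
      t_carrier by simp
  with t_eq show "extendable q \<alpha> m ?t" unfolding extendable_def by blast
  assume j: "j \<le> m"
  have "stieltjes_param q \<alpha> s (Suc j) = stieltjes_param q \<alpha> s' (Suc j)"
    by (rule stieltjes_param_cong) (use j eq in simp)
  also have "\<dots> = stieltjes_param q \<alpha> ?t' j"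
  proof (cases "even j")
    case True
    then obtain n where n: "j = 2 * n" by blast
    have "nonneg_hermitian (block_hankel q (shifted \<alpha> s') n)"
      by (rule nonneg_block_hankel_mono[OF q _ pos(2)])
        (use shifted_s_carrier j n in auto)
    from transform_shifted_step(2)[OF this] show ?thesis by (simp add: stieltjes_param_def n)
  next
    case False
    then obtain n where n: "j = Suc (2 * n)" by (metis oddE Suc_eq_plus1)
    have "nonneg_hermitian (block_hankel q s' (Suc n))"
      by (rule nonneg_block_hankel_mono[OF q _ pos(1)])
        (use s_carrier j n in auto)
    from transform_unshifted_step(2)[OF this] show ?thesis by (simp add: stieltjes_param_def n)
  qed
  also have "\<dots> = stieltjes_param q \<alpha> ?t j"
    by (rule stieltjes_param_cong) (use j t_eq in simp)
  finally show "stieltjes_param q \<alpha> s (Suc j) = stieltjes_param q \<alpha> ?t j" .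
qed

lemma stieltjes_param_schur_transform:
  assumes "0 < q" "extendable q \<alpha> m s" "k + j \<le> m"
  shows "stieltjes_param q \<alpha> s (k + j) = stieltjes_param q \<alpha> (schur_transform q \<alpha> k s) j"
  using assms(2,3)
proof (induction k arbitrary: s m)
  case 0
  thus ?case by (simp add: schur_transform_def)
next
  case (Suc k)
  obtain m' where m: "m = Suc m'" using Suc.prems(2) by (cases m) auto
  have ext: "extendable q \<alpha> (Suc m') s" using Suc.prems(1) m by simp
  have "stieltjes_param q \<alpha> s (Suc k + j) = stieltjes_param q \<alpha> (schur_transform1 q \<alpha> s) (k + j)"
    using schur_transform1_step(2)[OF assms(1) ext, of "k + j"] Suc.prems(2) m by simp
  also have "\<dots> = stieltjes_param q \<alpha> (schur_transform q \<alpha> k (schur_transform1 q \<alpha> s)) j"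
    by (rule Suc.IH[of m']) (use schur_transform1_step(1)[OF assms(1) ext] Suc.prems(2) m in simp_all)
  also have "schur_transform q \<alpha> k (schur_transform1 q \<alpha> s) = schur_transform q \<alpha> (Suc k) s"
    by (simp add: schur_transform_def funpow_swap1)
  finally show ?case .
qed

text \<open>For \<open>\<kappa> = \<infinity>\<close> the sequence extends each of its sections, and the section up to \<open>k + j\<close> contains all
  terms that enter the parameter of index \<open>k + j\<close>.\<close>

lemma K_ge_e_extendable:
  assumes "s \<in> K_ge_e q \<kappa> \<alpha>" "enat k \<le> \<kappa>" "enat j \<le> \<kappa> - enat k"
  shows "\<exists>m. k + j \<le> m \<and> extendable q \<alpha> m s"
proof (cases \<kappa>)
  case (enat m)
  obtain X where "s(Suc m := X) \<in> K_ge_fin q (Suc m) \<alpha>"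
    using assms(1) by (auto simp: enat K_ge_e_def K_ge_def)
  hence "extendable q \<alpha> m s"
    unfolding extendable_def by (intro exI[of _ "s(Suc m := X)"]) simp
  moreover have "k + j \<le> m" using assms(2,3) by (simp add: enat)
  ultimately show ?thesis by blast
next
  case infinity
  hence "s \<in> K_ge_fin q (Suc (k + j)) \<alpha>" using assms(1) by (simp add: K_ge_e_def K_ge_def)
  hence "extendable q \<alpha> (k + j) s" unfolding extendable_def by blast
  thus ?thesis by blast
qed

theorem theorem9p26:
  fixes q k :: nat and \<alpha> :: real and \<kappa> :: enat
    and s t Q :: "nat \<Rightarrow> complex mat"
  assumes "q \<ge> 1"
    and "s \<in> K_ge_e q \<kappa> \<alpha>"
    and "enat k \<le> \<kappa>"
    and "\<And>j. enat j \<le> \<kappa> - enat k \<Longrightarrow> t j = schur_transform q \<alpha> k s j"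
    and "\<And>j. enat j \<le> \<kappa> \<Longrightarrow> Q j = stieltjes_param q \<alpha> s j"
  shows "\<forall>j. enat j \<le> \<kappa> - enat k \<longrightarrow> Q (k + j) = stieltjes_param q \<alpha> t j"
proof (intro allI impI)
  fix j assume j: "enat j \<le> \<kappa> - enat k"
  obtain m where m: "k + j \<le> m" "extendable q \<alpha> m s"
    using K_ge_e_extendable[OF assms(2,3) j] by blast
  have "enat (k + j) \<le> \<kappa>" using assms(3) j by (cases \<kappa>) auto
  hence "Q (k + j) = stieltjes_param q \<alpha> s (k + j)" by (rule assms(5))
  also have "\<dots> = stieltjes_param q \<alpha> (schur_transform q \<alpha> k s) j"
    by (rule stieltjes_param_schur_transform[OF _ m(2,1)]) (use assms(1) in simp)
  also have "\<dots> = stieltjes_param q \<alpha> t j"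
  proof (rule stieltjes_param_cong)
    fix i assume "i \<le> j"
    hence "enat i \<le> \<kappa> - enat k" using j by (meson enat_ord_simps(1) order_trans)
    thus "schur_transform q \<alpha> k s i = t i" by (simp add: assms(4))
  qed
  finally show "Q (k + j) = stieltjes_param q \<alpha> t j" .
qed

end
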